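(* Let $\acute N$ be a radical screen transversal lightlike submanifold of a golden semi-Riemannian manifold $(\breve N,\breve g,\breve P)$. Then the screen distribution $S(T\acute N)$ is integrable if and only if $$h^s(W,\breve PU)=h^s(U,\breve PW)$$ for all $W,U\in\Gamma(S(T\acute N))$.
   Context: Golden semi-Riemannian manifold: a semi-Riemannian manifold $(\breve N,\breve g)$ with a $(1,1)$-tensor field $\breve P$ such that $\breve P^2=\breve P+I$ and $\breve g(\breve PW,U)=\breve g(W,\breve PU)$ for all vector fields $W,U$; moreover $\breve\nabla_W\breve PU=\breve P\breve\nabla_WU$, where $\breve\nabla$ is the Levi-Civita connection of $\breve g$. Lightlike submanifold: $\acute N$ is an immersed submanifold whose induced metric $g$ is degenerate, with $\mathrm{Rad}\,T\acute N=T\acute N\cap T\acute N^\perp$ a distribution of constant rank $r\ge1$. Fix a screen distribution $S(T\acute N)$ (a semi-Riemannian, i.e. nondegenerate, complement of $\mathrm{Rad}\,T\acute N$ in $T\acute N$), a screen transversal bundle $S(T\acute N^\perp)$ (a nondegenerate complement of $\mathrm{Rad}\,T\acute N$ in $T\acute N^\perp$), and the associated lightlike transversal bundle $\mathrm{ltr}(T\acute N)$, locally spanned by null sections $N_i$ orthogonal to $S(T\acute N)$, to $S(T\acute N^\perp)$ and to each other, with $\breve g(N_i,\xi_j)=\delta_{ij}$ for a local basis $\{\xi_j\}$ of $\mathrm{Rad}\,T\acute N$. Thus $T\breve N|_{\acute N}=S(T\acute N)\perp[\mathrm{Rad}\,T\acute N\oplus \mathrm{ltr}(T\acute N)]\perp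 S(T\acute N^\perp)$. Gauss formula, for $W,U\in\Gamma(T\acute N)$: $\breve\nabla_WU=\nabla_WU+h^\ell(W,U)+h^s(W,U)$, where $\nabla_WU\in\Gamma(T\acute N)$, $h^\ell(W,U)\in\Gamma(\mathrm{ltr}(T\acute N))$ and $h^s(W,U)\in\Gamma(S(T\acute N^\perp))$. $\acute N$ is a screen transversal lightlike submanifold if $\breve P\,\mathrm{Rad}\,T\acute N\subset S(T\acute N^\perp)$. It is radical screen transversal if in addition $\breve P(S(T\acute N))=S(T\acute N)$. *)

theory Defs
  imports "HOL-Analysis.Analysis"
begin

text \<open>
  A manifold is a whole type together with a smooth atlas; a chart is a pair of its domain and its
  coordinate map. Tangent vectors are encoded by coordinates: for every point \<open>p\<close> one chart
  \<open>chart_at M p\<close> around \<open>p\<close> is singled out, and the tangent space at \<open>p\<close> is the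
  model space \<open>'e\<close>, whose elements are read as component vectors with respect to
  \<open>chart_at M p\<close>. Components in other charts are obtained by the derivative of the
  change of coordinates. Hence a vector field is a function from points to \<open>'e\<close>, a metric is a
  family of bilinear forms on \<open>'e\<close>, and a subbundle is a family of subspaces of \<open>'e\<close>;
  smoothness is always tested on components in a fixed chart, never on these raw functions.
\<close>

section \<open>Smooth manifolds and vector fields\<close>

text \<open>\<open>C\<^sup>k\<close> on an open set; a \<open>C\<^sup>k\<close> derivative is tested direction by direction,
  which suffices because the domain is finite-dimensional.\<close>

fun Ck_on :: "nat \<Rightarrow> 'a::euclidean_space set \<Rightarrow> ('a \<Rightarrow> 'b::real_normed_vector) \<Rightarrow> bool" where
  "Ck_on 0 U f \<longleftrightarrow> continuous_on U f"
| "Ck_on (Suc k) U f \<longleftrightarrow> (\<forall>x\<in>U. f differentiable (at x)) \<and>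
     (\<forall>v. Ck_on k U (\<lambda>x. frechet_derivative f (at x) v))"

definition smooth_on :: "'a::euclidean_space set \<Rightarrow> ('a \<Rightarrow> 'b::real_normed_vector) \<Rightarrow> bool" where
  "smooth_on U f \<longleftrightarrow> (\<forall>k. Ck_on k U f)"

type_synonym ('m, 'e) chart = "'m set \<times> ('m \<Rightarrow> 'e)"

type_synonym ('m, 'e) atlas = "('m, 'e) chart set"

definition chart_inv :: "('m, 'e) chart \<Rightarrow> 'e \<Rightarrow> 'm" where
  "chart_inv c = inv_into (fst c) (snd c)"

definition smooth_manifold ::
  "('m::{t2_space, second_countable_topology}, 'e::euclidean_space) atlas \<Rightarrow> bool" where
  "smooth_manifold M \<longleftrightarrow>
     (\<Union>c\<in>M. fst c) = UNIV \<and>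
     (\<forall>c\<in>M. open (fst c) \<and> open (snd c ` fst c) \<and>
        homeomorphism (fst c) (snd c ` fst c) (snd c) (chart_inv c)) \<and>
     (\<forall>c\<in>M. \<forall>c'\<in>M. smooth_on (snd c ` (fst c \<inter> fst c')) (snd c' \<circ> chart_inv c))"

definition chart_at :: "('m, 'e) atlas \<Rightarrow> 'm \<Rightarrow> ('m, 'e) chart" where
  "chart_at M p = (SOME c. c \<in> M \<and> p \<in> fst c)"

definition smooth_fun_on ::
  "('m, 'e::euclidean_space) atlas \<Rightarrow> 'm set \<Rightarrow> ('m \<Rightarrow> 'b::real_normed_vector) \<Rightarrow> bool" where
  "smooth_fun_on M U h \<longleftrightarrow> (\<forall>c\<in>M. smooth_on (snd c ` (fst c \<inter> U)) (h \<circ> chart_inv c))"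

text \<open>The derivative of \<open>h\<close> in the direction of the tangent vector \<open>v\<close> at \<open>p\<close>.\<close>

definition dir_deriv ::
  "('m, 'e::euclidean_space) atlas \<Rightarrow> ('m \<Rightarrow> 'b::real_normed_vector) \<Rightarrow> 'm \<Rightarrow> 'e \<Rightarrow> 'b" where
  "dir_deriv M h p v =
     frechet_derivative (h \<circ> chart_inv (chart_at M p)) (at (snd (chart_at M p) p)) v"

text \<open>The components in the chart \<open>c\<close> of the tangent vector \<open>v\<close> at \<open>p\<close>.\<close>

definition components ::
  "('m, 'e::euclidean_space) atlas \<Rightarrow> ('m, 'e) chart \<Rightarrow> 'm \<Rightarrow> 'e \<Rightarrow> 'e" where
  "components M c p v = dir_deriv M (snd c) p v"

text \<open>The local vector field on the domain of \<open>c\<close> whose components in \<open>c\<close> are constantly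
  \<open>v\<close>, i.e. the linear combination of coordinate fields with coefficients \<open>v\<close>.\<close>

definition coord_field ::
  "('m, 'e::euclidean_space) atlas \<Rightarrow> ('m, 'e) chart \<Rightarrow> 'e \<Rightarrow> 'm \<Rightarrow> 'e" where
  "coord_field M c v q =
     frechet_derivative (snd (chart_at M q) \<circ> chart_inv c) (at (snd c q)) v"

definition smooth_vector_field_on ::
  "('m, 'e::euclidean_space) atlas \<Rightarrow> 'm set \<Rightarrow> ('m \<Rightarrow> 'e) \<Rightarrow> bool" where
  "smooth_vector_field_on M U X \<longleftrightarrow>
     (\<forall>c\<in>M. smooth_fun_on M (U \<inter> fst c) (\<lambda>q. components M c q (X q)))"

text \<open>\<open>[X, Y] = (X Y\<^sup>i - Y X\<^sup>i) \<partial>\<^sub>i\<close>, evaluated at \<open>p\<close> in the chart \<open>chart_at M p\<close>, in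
  which tangent vectors at \<open>p\<close> are their own components.\<close>

definition lie_bracket ::
  "('m, 'e::euclidean_space) atlas \<Rightarrow> ('m \<Rightarrow> 'e) \<Rightarrow> ('m \<Rightarrow> 'e) \<Rightarrow> 'm \<Rightarrow> 'e" where
  "lie_bracket M X Y p = (let c = chart_at M p in
     dir_deriv M (\<lambda>q. components M c q (Y q)) p (X p) -
     dir_deriv M (\<lambda>q. components M c q (X q)) p (Y p))"


section \<open>Golden semi-Riemannian manifolds\<close>

definition nondegenerate_on :: "('e::real_vector \<Rightarrow> 'e \<Rightarrow> real) \<Rightarrow> 'e set \<Rightarrow> bool" where
  "nondegenerate_on b V \<longleftrightarrow> (\<forall>v\<in>V. (\<forall>w\<in>V. b v w = 0) \<longrightarrow> v = 0)"

definition form_index :: "('e::euclidean_space \<Rightarrow> 'e \<Rightarrow> real) \<Rightarrow> nat" where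
  "form_index b =
     (GREATEST k. \<exists>V. subspace V \<and> dim V = k \<and> (\<forall>v\<in>V. v \<noteq> 0 \<longrightarrow> b v v < 0))"

definition semi_riemannian_metric ::
  "('m::topological_space, 'e::euclidean_space) atlas \<Rightarrow> ('m \<Rightarrow> 'e \<Rightarrow> 'e \<Rightarrow> real) \<Rightarrow> bool" where
  "semi_riemannian_metric M g \<longleftrightarrow>
     (\<forall>p. bilinear (g p) \<and> (\<forall>v w. g p v w = g p w v) \<and> nondegenerate_on (g p) UNIV) \<and>
     (\<exists>\<nu>. \<forall>p. form_index (g p) = \<nu>) \<and>
     (\<forall>U X Y. open U \<and> smooth_vector_field_on M U X \<and> smooth_vector_field_on M U Y \<longrightarrow>
        smooth_fun_on M U (\<lambda>p. g p (X p) (Y p)))"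

definition smooth_endomorphism ::
  "('m::topological_space, 'e::euclidean_space) atlas \<Rightarrow> ('m \<Rightarrow> 'e \<Rightarrow> 'e) \<Rightarrow> bool" where
  "smooth_endomorphism M P \<longleftrightarrow>
     (\<forall>p. linear (P p)) \<and>
     (\<forall>U X. open U \<and> smooth_vector_field_on M U X \<longrightarrow>
        smooth_vector_field_on M U (\<lambda>p. P p (X p)))"

text \<open>Connections act on the smooth vector fields of every open set \<open>U\<close>, compatibly with
  restriction; \<open>nabla X Y\<close> is arbitrary where \<open>X\<close> or \<open>Y\<close> is not smooth.\<close>

definition affine_connection ::
  "('m::topological_space, 'e::euclidean_space) atlas
     \<Rightarrow> (('m \<Rightarrow> 'e) \<Rightarrow> ('m \<Rightarrow> 'e) \<Rightarrow> 'm \<Rightarrow> 'e) \<Rightarrow> bool" where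
  "affine_connection M nabla \<longleftrightarrow>
     (\<forall>U X Y. open U \<and> smooth_vector_field_on M U X \<and> smooth_vector_field_on M U Y \<longrightarrow>
        smooth_vector_field_on M U (nabla X Y) \<and>
        (\<forall>X' Y'. (\<forall>p\<in>U. X' p = X p \<and> Y' p = Y p) \<longrightarrow> (\<forall>p\<in>U. nabla X' Y' p = nabla X Y p)) \<and>
        (\<forall>X'. smooth_vector_field_on M U X' \<longrightarrow>
           (\<forall>p\<in>U. nabla (\<lambda>q. X q + X' q) Y p = nabla X Y p + nabla X' Y p)) \<and>
        (\<forall>Y'. smooth_vector_field_on M U Y' \<longrightarrow>
           (\<forall>p\<in>U. nabla X (\<lambda>q. Y q + Y' q) p = nabla X Y p + nabla X Y' p)) \<and>
        (\<forall>h::'m \<Rightarrow> real. smooth_fun_on M U h \<longrightarrow>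
           (\<forall>p\<in>U. nabla (\<lambda>q. h q *\<^sub>R X q) Y p = h p *\<^sub>R nabla X Y p \<and>
              nabla X (\<lambda>q. h q *\<^sub>R Y q) p =
                dir_deriv M h p (X p) *\<^sub>R Y p + h p *\<^sub>R nabla X Y p)))"

definition levi_civita ::
  "('m::topological_space, 'e::euclidean_space) atlas \<Rightarrow> ('m \<Rightarrow> 'e \<Rightarrow> 'e \<Rightarrow> real)
     \<Rightarrow> (('m \<Rightarrow> 'e) \<Rightarrow> ('m \<Rightarrow> 'e) \<Rightarrow> 'm \<Rightarrow> 'e) \<Rightarrow> bool" where
  "levi_civita M g nabla \<longleftrightarrow>
     affine_connection M nabla \<and>
     (\<forall>U X Y. open U \<and> smooth_vector_field_on M U X \<and> smooth_vector_field_on M U Y \<longrightarrow>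
        (\<forall>p\<in>U. nabla X Y p - nabla Y X p = lie_bracket M X Y p) \<and>
        (\<forall>Z. smooth_vector_field_on M U Z \<longrightarrow>
           (\<forall>p\<in>U. dir_deriv M (\<lambda>q. g q (Y q) (Z q)) p (X p) =
              g p (nabla X Y p) (Z p) + g p (Y p) (nabla X Z p))))"

definition golden_semi_riemannian_manifold ::
  "('m::{t2_space, second_countable_topology}, 'e::euclidean_space) atlas
     \<Rightarrow> ('m \<Rightarrow> 'e \<Rightarrow> 'e \<Rightarrow> real) \<Rightarrow> ('m \<Rightarrow> 'e \<Rightarrow> 'e)
     \<Rightarrow> (('m \<Rightarrow> 'e) \<Rightarrow> ('m \<Rightarrow> 'e) \<Rightarrow> 'm \<Rightarrow> 'e) \<Rightarrow> bool" where
  "golden_semi_riemannian_manifold M g P nabla \<longleftrightarrow>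
     smooth_manifold M \<and> semi_riemannian_metric M g \<and> levi_civita M g nabla \<and>
     smooth_endomorphism M P \<and>
     (\<forall>p v. P p (P p v) = P p v + v) \<and>
     (\<forall>p v w. g p (P p v) w = g p v (P p w)) \<and>
     (\<forall>U X Y. open U \<and> smooth_vector_field_on M U X \<and> smooth_vector_field_on M U Y \<longrightarrow>
        (\<forall>p\<in>U. nabla X (\<lambda>q. P q (Y q)) p = P p (nabla X Y p)))"


section \<open>Immersed submanifolds\<close>

definition smooth_map ::
  "('n::topological_space, 'd::euclidean_space) atlas
     \<Rightarrow> ('m::topological_space, 'e::euclidean_space) atlas \<Rightarrow> ('n \<Rightarrow> 'm) \<Rightarrow> bool" where
  "smooth_map N M f \<longleftrightarrow> continuous_on UNIV f \<and>
     (\<forall>c\<in>M. smooth_fun_on N (f -` fst c) (snd c \<circ> f))"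

definition differential ::
  "('n, 'd::euclidean_space) atlas \<Rightarrow> ('m, 'e::euclidean_space) atlas
     \<Rightarrow> ('n \<Rightarrow> 'm) \<Rightarrow> 'n \<Rightarrow> 'd \<Rightarrow> 'e" where
  "differential N M f p v = dir_deriv N (snd (chart_at M (f p)) \<circ> f) p v"

text \<open>Global injectivity of \<open>f\<close> is not required, so that both conventions for immersed
  submanifolds are covered.\<close>

definition immersion ::
  "('n::topological_space, 'd::euclidean_space) atlas
     \<Rightarrow> ('m::topological_space, 'e::euclidean_space) atlas \<Rightarrow> ('n \<Rightarrow> 'm) \<Rightarrow> bool" where
  "immersion N M f \<longleftrightarrow> smooth_map N M f \<and> (\<forall>p. inj (differential N M f p))"

text \<open>Sections of the pulled-back tangent bundle: \<open>V p\<close> is a tangent vector of the ambient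
  manifold at \<open>f p\<close>.\<close>

definition smooth_along_on ::
  "('n, 'd::euclidean_space) atlas \<Rightarrow> ('m, 'e::euclidean_space) atlas \<Rightarrow> ('n \<Rightarrow> 'm)
     \<Rightarrow> 'n set \<Rightarrow> ('n \<Rightarrow> 'e) \<Rightarrow> bool" where
  "smooth_along_on N M f U V \<longleftrightarrow>
     (\<forall>c\<in>M. smooth_fun_on N (U \<inter> f -` fst c) (\<lambda>q. components M c (f q) (V q)))"

text \<open>Smooth subbundles of the pulled-back tangent bundle. All bundles over the submanifold, its
  tangent bundle included, are treated in this way, the tangent space at \<open>p\<close> being
  identified with its image under the differential.\<close>

definition subbundle ::
  "('n::topological_space, 'd::euclidean_space) atlas \<Rightarrow> ('m, 'e::euclidean_space) atlas
     \<Rightarrow> ('n \<Rightarrow> 'm) \<Rightarrow> nat \<Rightarrow> ('n \<Rightarrow> 'e set) \<Rightarrow> bool" where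
  "subbundle N M f k D \<longleftrightarrow>
     (\<forall>p. subspace (D p) \<and> dim (D p) = k) \<and>
     (\<forall>p. \<exists>B E. open B \<and> p \<in> B \<and> (\<forall>i<k. smooth_along_on N M f B (E i)) \<and>
        (\<forall>q\<in>B. D q = span ((\<lambda>i. E i q) ` {..<k})))"

definition tangent_bundle ::
  "('n, 'd::euclidean_space) atlas \<Rightarrow> ('m, 'e::euclidean_space) atlas
     \<Rightarrow> ('n \<Rightarrow> 'm) \<Rightarrow> 'n \<Rightarrow> 'e set" where
  "tangent_bundle N M f p = range (differential N M f p)"

definition normal_bundle ::
  "('n, 'd::euclidean_space) atlas \<Rightarrow> ('m, 'e::euclidean_space) atlas \<Rightarrow> ('n \<Rightarrow> 'm)
     \<Rightarrow> ('m \<Rightarrow> 'e \<Rightarrow> 'e \<Rightarrow> real) \<Rightarrow> 'n \<Rightarrow> 'e set" where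
  "normal_bundle N M f g p = {v. \<forall>w\<in>tangent_bundle N M f p. g (f p) v w = 0}"

definition radical_bundle ::
  "('n, 'd::euclidean_space) atlas \<Rightarrow> ('m, 'e::euclidean_space) atlas \<Rightarrow> ('n \<Rightarrow> 'm)
     \<Rightarrow> ('m \<Rightarrow> 'e \<Rightarrow> 'e \<Rightarrow> real) \<Rightarrow> 'n \<Rightarrow> 'e set" where
  "radical_bundle N M f g p = tangent_bundle N M f p \<inter> normal_bundle N M f g p"

text \<open>Vector fields on the submanifold tangent to \<open>D\<close>, i.e. sections of a distribution
  \<open>D\<close> contained in the tangent bundle.\<close>

definition tangent_section ::
  "('n, 'd::euclidean_space) atlas \<Rightarrow> ('m, 'e::euclidean_space) atlas \<Rightarrow> ('n \<Rightarrow> 'm)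
     \<Rightarrow> ('n \<Rightarrow> 'e set) \<Rightarrow> ('n \<Rightarrow> 'd) \<Rightarrow> bool" where
  "tangent_section N M f D W \<longleftrightarrow>
     smooth_vector_field_on N UNIV W \<and> (\<forall>p. differential N M f p (W p) \<in> D p)"

text \<open>Integrability of a distribution in the sense of Spivak and Warner: its sections are closed
  under the Lie bracket of the submanifold.\<close>

definition integrable_distribution ::
  "('n, 'd::euclidean_space) atlas \<Rightarrow> ('m, 'e::euclidean_space) atlas \<Rightarrow> ('n \<Rightarrow> 'm)
     \<Rightarrow> ('n \<Rightarrow> 'e set) \<Rightarrow> bool" where
  "integrable_distribution N M f D \<longleftrightarrow>
     (\<forall>W U. tangent_section N M f D W \<and> tangent_section N M f D U \<longrightarrow>
        (\<forall>p. differential N M f p (lie_bracket N W U p) \<in> D p))"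

text \<open>The connection induced on vector fields \<open>V\<close> along \<open>f\<close>. In a chart around \<open>f p\<close> with
  coordinate fields \<open>\<partial>\<^sub>i\<close> and \<open>V = V\<^sup>i \<partial>\<^sub>i\<close>, the Leibniz rule gives
  \<open>nabla\<^sub>W V = (W V\<^sup>i) \<partial>\<^sub>i + V\<^sup>i nabla\<^sub>W \<partial>\<^sub>i\<close>; the second term is that of the fields with
  constant components. The chart used is \<open>chart_at M (f p)\<close>, in which tangent vectors at
  \<open>f p\<close> are their own components.\<close>

definition nabla_along ::
  "('n, 'd::euclidean_space) atlas \<Rightarrow> ('m, 'e::euclidean_space) atlas \<Rightarrow> ('n \<Rightarrow> 'm)
     \<Rightarrow> (('m \<Rightarrow> 'e) \<Rightarrow> ('m \<Rightarrow> 'e) \<Rightarrow> 'm \<Rightarrow> 'e)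
     \<Rightarrow> ('n \<Rightarrow> 'd) \<Rightarrow> ('n \<Rightarrow> 'e) \<Rightarrow> 'n \<Rightarrow> 'e" where
  "nabla_along N M f nabla W V p = (let c = chart_at M (f p) in
     dir_deriv N (\<lambda>q. components M c (f q) (V q)) p (W p) +
     nabla (coord_field M c (differential N M f p (W p))) (coord_field M c (V p)) (f p))"


section \<open>Lightlike submanifolds\<close>

definition nondegenerate_complement ::
  "('e::real_vector \<Rightarrow> 'e \<Rightarrow> real) \<Rightarrow> 'e set \<Rightarrow> 'e set \<Rightarrow> 'e set \<Rightarrow> bool" where
  "nondegenerate_complement b A B C \<longleftrightarrow>
     A \<inter> B = {0} \<and> {x + y |x y. x \<in> A \<and> y \<in> B} = C \<and> nondegenerate_on b A"

definition lightlike_transversal ::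
  "('n::topological_space, 'd::euclidean_space) atlas \<Rightarrow> ('m, 'e::euclidean_space) atlas
     \<Rightarrow> ('n \<Rightarrow> 'm) \<Rightarrow> ('m \<Rightarrow> 'e \<Rightarrow> 'e \<Rightarrow> real) \<Rightarrow> nat
     \<Rightarrow> ('n \<Rightarrow> 'e set) \<Rightarrow> ('n \<Rightarrow> 'e set) \<Rightarrow> ('n \<Rightarrow> 'e set) \<Rightarrow> bool" where
  "lightlike_transversal N M f g r S SP L \<longleftrightarrow>
     (\<forall>p. \<exists>B \<xi> n. open B \<and> p \<in> B \<and>
        (\<forall>i<r. smooth_along_on N M f B (\<xi> i) \<and> smooth_along_on N M f B (n i)) \<and>
        (\<forall>q\<in>B.
           radical_bundle N M f g q = span ((\<lambda>i. \<xi> i q) ` {..<r}) \<and>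
           L q = span ((\<lambda>i. n i q) ` {..<r}) \<and>
           (\<forall>i<r. (\<forall>v\<in>S q \<union> SP q. g (f q) (n i q) v = 0) \<and>
              (\<forall>j<r. g (f q) (n i q) (n j q) = 0 \<and>
                 g (f q) (n i q) (\<xi> j q) = (if i = j then 1 else 0)))))"

text \<open>\<open>S\<close> is the screen distribution, \<open>SP\<close> the screen transversal bundle and \<open>L\<close> the
  lightlike transversal bundle.\<close>

definition lightlike_submanifold ::
  "('n::{t2_space, second_countable_topology}, 'd::euclidean_space) atlas
     \<Rightarrow> ('m::topological_space, 'e::euclidean_space) atlas
     \<Rightarrow> ('n \<Rightarrow> 'm) \<Rightarrow> ('m \<Rightarrow> 'e \<Rightarrow> 'e \<Rightarrow> real)
     \<Rightarrow> ('n \<Rightarrow> 'e set) \<Rightarrow> ('n \<Rightarrow> 'e set) \<Rightarrow> ('n \<Rightarrow> 'e set) \<Rightarrow> bool" where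
  "lightlike_submanifold N M f g S SP L \<longleftrightarrow>
     smooth_manifold N \<and> immersion N M f \<and>
     (\<exists>r\<ge>1. subbundle N M f r (radical_bundle N M f g) \<and>
        (\<exists>k. subbundle N M f k S) \<and>
        (\<forall>p. nondegenerate_complement (g (f p)) (S p) (radical_bundle N M f g p)
               (tangent_bundle N M f p)) \<and>
        (\<exists>k. subbundle N M f k SP) \<and>
        (\<forall>p. nondegenerate_complement (g (f p)) (SP p) (radical_bundle N M f g p)
               (normal_bundle N M f g p)) \<and>
        lightlike_transversal N M f g r S SP L)"

text \<open>The Gauss formula splits \<open>nabla\<^sub>W V\<close> into its components in \<open>TN\<close>, \<open>ltr(TN)\<close> and
  \<open>S(TN\<^sup>\<bottom>)\<close>; this is the last one. The tangent field in the second slot is given as a field along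
  \<open>f\<close> with values in the tangent bundle.\<close>

definition screen_second_fundamental_form ::
  "('n, 'd::euclidean_space) atlas \<Rightarrow> ('m, 'e::euclidean_space) atlas \<Rightarrow> ('n \<Rightarrow> 'm)
     \<Rightarrow> (('m \<Rightarrow> 'e) \<Rightarrow> ('m \<Rightarrow> 'e) \<Rightarrow> 'm \<Rightarrow> 'e)
     \<Rightarrow> ('n \<Rightarrow> 'e set) \<Rightarrow> ('n \<Rightarrow> 'e set) \<Rightarrow> ('n \<Rightarrow> 'd) \<Rightarrow> ('n \<Rightarrow> 'e) \<Rightarrow> 'n \<Rightarrow> 'e" where
  "screen_second_fundamental_form N M f nabla SP L W V p =
     (THE s. s \<in> SP p \<and> (\<exists>t\<in>tangent_bundle N M f p. \<exists>l\<in>L p.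
        nabla_along N M f nabla W V p = t + l + s))"

definition screen_transversal ::
  "('n, 'd::euclidean_space) atlas \<Rightarrow> ('m, 'e::euclidean_space) atlas \<Rightarrow> ('n \<Rightarrow> 'm)
     \<Rightarrow> ('m \<Rightarrow> 'e \<Rightarrow> 'e \<Rightarrow> real) \<Rightarrow> ('m \<Rightarrow> 'e \<Rightarrow> 'e) \<Rightarrow> ('n \<Rightarrow> 'e set) \<Rightarrow> bool" where
  "screen_transversal N M f g P SP \<longleftrightarrow>
     (\<forall>p. P (f p) ` radical_bundle N M f g p \<subseteq> SP p)"

definition radical_screen_transversal ::
  "('n, 'd::euclidean_space) atlas \<Rightarrow> ('m, 'e::euclidean_space) atlas \<Rightarrow> ('n \<Rightarrow> 'm)
     \<Rightarrow> ('m \<Rightarrow> 'e \<Rightarrow> 'e \<Rightarrow> real) \<Rightarrow> ('m \<Rightarrow> 'e \<Rightarrow> 'e)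
     \<Rightarrow> ('n \<Rightarrow> 'e set) \<Rightarrow> ('n \<Rightarrow> 'e set) \<Rightarrow> bool" where
  "radical_screen_transversal N M f g P S SP \<longleftrightarrow>
     screen_transversal N M f g P SP \<and> (\<forall>p. P (f p) ` S p = S p)"

end

theory Submission
  imports Defs
begin

text \<open>
  For sections \<open>W, U\<close> of the screen distribution, the golden structure \<open>P\<close> commutes with the
  connection along the immersion \<open>f\<close>, and that connection is torsion-free. Hence
  \<open>nabla\<^sub>W (P df U) - nabla\<^sub>U (P df W) = P df [W, U]\<close>. Write the tangent vector \<open>df [W, U]\<close> as
  \<open>\<sigma> + \<rho>\<close> with \<open>\<sigma>\<close> in the screen and \<open>\<rho>\<close> in the radical. Since \<open>P\<close> preserves the screen and maps
  the radical into the screen transversal bundle, the screen transversal part of the right-hand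
  side is \<open>P \<rho>\<close>. As \<open>P\<^sup>2 = P + I\<close> makes \<open>P\<close> injective, \<open>h\<^sup>s(W, P U) = h\<^sup>s(U, P W)\<close> at a point holds if
  and only if \<open>\<rho> = 0\<close> there, that is, if \<open>[W, U]\<close> lies in the screen. This last step is
  \<open>golden_screen_criterion\<close>; it rests on the splitting of the ambient tangent space, which also
  shows that \<open>h\<^sup>s\<close> is well defined (\<open>splitting_exists\<close>, \<open>splitting_unique\<close>).

  The differential-geometric content is therefore in two facts about fields along \<open>f\<close>:
  \<open>nabla_along_parallel_endomorphism\<close> and \<open>nabla_along_torsion_free\<close>. Both are computed in the
  distinguished charts at a point and its image. There a connection is the derivative of
  components plus the connection of coordinate fields (\<open>connection_in_chart\<close>). The first fact follows
  from the chain rule; the second needs that the coordinate representation of \<open>f\<close> has symmetric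
  second derivatives (\<open>mixed_derivatives_commute\<close>) and that coordinate fields commute.
\<close>

section \<open>Calculus of smooth functions on open sets\<close>

lemma frechet_derivative_cong_open:
  assumes "open U" "x \<in> U" "\<And>y. y \<in> U \<Longrightarrow> f y = h y"
  shows "frechet_derivative f (at x) = frechet_derivative h (at x)"
proof -
  have "(f has_derivative D) (at x) \<longleftrightarrow> (h has_derivative D) (at x)" for D
    using assms has_derivative_transform_within_open[of f D x UNIV U h]
      has_derivative_transform_within_open[of h D x UNIV U f] by auto
  then show ?thesis unfolding frechet_derivative_def by simp
qed

lemma differentiable_cong_open:
  assumes "f differentiable at x" "open U" "x \<in> U" "\<And>y. y \<in> U \<Longrightarrow> f y = h y"
  shows "h differentiable at x"
  using assms has_derivative_transform_within_open[of f _ x UNIV U h]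
  unfolding differentiable_def by blast

lemma frechet_derivative_eqI:
  "(f has_derivative D) (at x) \<Longrightarrow> frechet_derivative f (at x) v = D v"
  by (metis frechet_derivative_at)

lemma Ck_on_has_derivative:
  "Ck_on (Suc k) U f \<Longrightarrow> x \<in> U \<Longrightarrow> (f has_derivative frechet_derivative f (at x)) (at x)"
  using frechet_derivative_works by auto

lemma Ck_on_cong:
  assumes "open U" "\<And>x. x \<in> U \<Longrightarrow> f x = h x" "Ck_on k U f"
  shows "Ck_on k U h"
  using assms(2,3)
proof (induction k arbitrary: f h)
  case 0
  then show ?case using continuous_on_cong by fastforce
next
  case (Suc k)
  have "Ck_on k U (\<lambda>x. frechet_derivative h (at x) v)" for v
    by (rule Suc.IH[of "\<lambda>x. frechet_derivative f (at x) v"])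
      (use frechet_derivative_cong_open[OF assms(1), of _ f h] Suc.prems in auto)
  moreover have "h differentiable at x" if "x \<in> U" for x
    using differentiable_cong_open[OF _ assms(1) that] Suc.prems that by auto
  ultimately show ?case by auto
qed

lemma Ck_on_subset: "Ck_on k U f \<Longrightarrow> V \<subseteq> U \<Longrightarrow> Ck_on k V f"
  by (induction k arbitrary: f) (auto intro: continuous_on_subset)

lemma Ck_on_Suc_imp: "Ck_on (Suc k) U f \<Longrightarrow> Ck_on k U f"
proof (induction k arbitrary: f)
  case 0
  then show ?case
    by (auto intro!: continuous_at_imp_continuous_on differentiable_imp_continuous_within)
next
  case (Suc k)
  then show ?case by (metis Ck_on.simps(2))
qed

lemma Ck_on_linear:
  assumes "bounded_linear A" "open U" "Ck_on k U f"
  shows "Ck_on k U (\<lambda>x. A (f x))"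
  using assms(3)
proof (induction k arbitrary: f)
  case 0
  then show ?case using assms(1) by (auto intro: bounded_linear.continuous_on)
next
  case (Suc k)
  have D: "((\<lambda>x. A (f x)) has_derivative (\<lambda>v. A (frechet_derivative f (at x) v))) (at x)"
    if "x \<in> U" for x
    by (rule bounded_linear.has_derivative[OF assms(1) Ck_on_has_derivative[OF Suc.prems that]])
  have "Ck_on k U (\<lambda>x. frechet_derivative (\<lambda>x. A (f x)) (at x) v)" for v
    by (rule Ck_on_cong[OF assms(2), rotated, OF Suc.IH[of "\<lambda>x. frechet_derivative f (at x) v"]])
      (use Suc.prems frechet_derivative_eqI[OF D] in auto)
  then show ?case using D unfolding Ck_on.simps differentiable_def by blast
qed

lemma Ck_on_const: "Ck_on k U (\<lambda>x. a)"
  by (induction k arbitrary: a) auto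

lemma Ck_on_add:
  assumes "open U" "Ck_on k U f" "Ck_on k U h"
  shows "Ck_on k U (\<lambda>x. f x + h x)"
  using assms(2,3)
proof (induction k arbitrary: f h)
  case 0
  then show ?case by (auto intro: continuous_intros)
next
  case (Suc k)
  have D: "((\<lambda>x. f x + h x) has_derivative
      (\<lambda>v. frechet_derivative f (at x) v + frechet_derivative h (at x) v)) (at x)"
    if "x \<in> U" for x
    by (intro has_derivative_add Ck_on_has_derivative[OF Suc.prems(1) that]
        Ck_on_has_derivative[OF Suc.prems(2) that])
  have "Ck_on k U (\<lambda>x. frechet_derivative (\<lambda>x. f x + h x) (at x) v)" for v
    by (rule Ck_on_cong[OF assms(1), rotated, OF Suc.IH[of "\<lambda>x. frechet_derivative f (at x) v"
            "\<lambda>x. frechet_derivative h (at x) v"]])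
      (use Suc.prems frechet_derivative_eqI[OF D] in auto)
  then show ?case using D unfolding Ck_on.simps differentiable_def by blast
qed

lemma Ck_on_scaleR:
  assumes "open U" "Ck_on k U r" "Ck_on k U f"
  shows "Ck_on k U (\<lambda>x. r x *\<^sub>R f x)"
  using assms(2,3)
proof (induction k arbitrary: r f)
  case 0
  then show ?case by (auto intro: continuous_intros)
next
  case (Suc k)
  have D: "((\<lambda>x. r x *\<^sub>R f x) has_derivative
      (\<lambda>v. r x *\<^sub>R frechet_derivative f (at x) v + frechet_derivative r (at x) v *\<^sub>R f x)) (at x)"
    if "x \<in> U" for x
    by (intro has_derivative_scaleR Ck_on_has_derivative[OF Suc.prems(1) that]
        Ck_on_has_derivative[OF Suc.prems(2) that])
  have "Ck_on k U (\<lambda>x. r x *\<^sub>R frechet_derivative f (at x) v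
          + frechet_derivative r (at x) v *\<^sub>R f x)" for v
    using Suc.prems Ck_on_Suc_imp[OF Suc.prems(1)] Ck_on_Suc_imp[OF Suc.prems(2)]
    by (intro Ck_on_add[OF assms(1)] Suc.IH) auto
  then have "Ck_on k U (\<lambda>x. frechet_derivative (\<lambda>x. r x *\<^sub>R f x) (at x) v)" for v
    by (rule Ck_on_cong[OF assms(1), rotated]) (use frechet_derivative_eqI[OF D] in auto)
  then show ?case using D unfolding Ck_on.simps differentiable_def by blast
qed

lemma Ck_on_sum:
  assumes "open U" "finite I" "\<And>i. i \<in> I \<Longrightarrow> Ck_on k U (f i)"
  shows "Ck_on k U (\<lambda>x. \<Sum>i\<in>I. f i x)"
  using assms(2,3) by (induction I) (auto intro: Ck_on_add[OF assms(1)] Ck_on_const)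

lemma linear_eq_sum_Basis:
  fixes A :: "'a::euclidean_space \<Rightarrow> 'b::real_vector"
  assumes "linear A"
  shows "A v = (\<Sum>b\<in>Basis. (v \<bullet> b) *\<^sub>R A b)"
  by (subst euclidean_representation[of v, symmetric])
    (simp add: linear_sum[OF assms] linear_scale[OF assms])

text \<open>Expanding \<open>D(h \<circ> f)(x) v = Dh(f x)(Df(x) v)\<close> in a basis leaves products of functions that are
  covered by the induction hypothesis for the partial derivatives of \<open>h\<close>.\<close>

lemma Ck_on_compose:
  fixes f :: "'a::euclidean_space \<Rightarrow> 'b::euclidean_space" and h :: "'b \<Rightarrow> 'c::real_normed_vector"
  assumes "open U" "Ck_on k U f" "Ck_on k V h" "f ` U \<subseteq> V"
  shows "Ck_on k U (h \<circ> f)"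
  using assms(2,3)
proof (induction k arbitrary: h)
  case 0
  then show ?case using assms(4) continuous_on_compose[of U f h] continuous_on_subset[of V h "f ` U"] by simp
next
  case (Suc k)
  have diff: "f differentiable at x" "h differentiable at (f x)" if "x \<in> U" for x
    using Suc.prems that assms(4) by auto
  have D: "frechet_derivative (h \<circ> f) (at x) v
      = (\<Sum>b\<in>Basis. (frechet_derivative f (at x) v \<bullet> b) *\<^sub>R frechet_derivative h (at (f x)) b)"
    if "x \<in> U" for x v
    using frechet_derivative_compose[OF diff[OF that]]
      linear_eq_sum_Basis[OF linear_frechet_derivative[OF diff(2)[OF that]]]
    by (metis comp_apply)
  have "Ck_on k U (\<lambda>x. frechet_derivative f (at x) v \<bullet> b)" for v b
    by (rule Ck_on_linear[OF bounded_linear_inner_left assms(1)]) (use Suc.prems in simp)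
  moreover have "Ck_on k U (\<lambda>x. frechet_derivative h (at (f x)) b)" for b
    using Suc.IH[OF Ck_on_Suc_imp[OF Suc.prems(1)], of "\<lambda>y. frechet_derivative h (at y) b"] Suc.prems(2)
    by (simp add: comp_def)
  ultimately have "Ck_on k U (\<lambda>x. \<Sum>b\<in>Basis. (frechet_derivative f (at x) v \<bullet> b) *\<^sub>R
      frechet_derivative h (at (f x)) b)" for v
    by (intro Ck_on_sum[OF assms(1)] Ck_on_scaleR[OF assms(1)]) auto
  then have "Ck_on k U (\<lambda>x. frechet_derivative (h \<circ> f) (at x) v)" for v
    by (rule Ck_on_cong[OF assms(1), rotated]) (use D in auto)
  moreover have "(h \<circ> f) differentiable at x" if "x \<in> U" for x
    using differentiable_chain_at[OF diff[OF that]] .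
  ultimately show ?case unfolding Ck_on.simps by blast
qed

lemma smooth_on_cong:
  "open U \<Longrightarrow> smooth_on U f \<Longrightarrow> (\<And>x. x \<in> U \<Longrightarrow> f x = h x) \<Longrightarrow> smooth_on U h"
  unfolding smooth_on_def using Ck_on_cong by blast

lemma smooth_on_subset: "smooth_on U f \<Longrightarrow> V \<subseteq> U \<Longrightarrow> smooth_on V f"
  unfolding smooth_on_def using Ck_on_subset by blast

lemma smooth_on_linear:
  "bounded_linear A \<Longrightarrow> open U \<Longrightarrow> smooth_on U f \<Longrightarrow> smooth_on U (\<lambda>x. A (f x))"
  unfolding smooth_on_def using Ck_on_linear by blast

lemma smooth_on_const: "smooth_on U (\<lambda>x. a)"
  unfolding smooth_on_def using Ck_on_const by blast

lemma smooth_on_add: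
  "open U \<Longrightarrow> smooth_on U f \<Longrightarrow> smooth_on U h \<Longrightarrow> smooth_on U (\<lambda>x. f x + h x)"
  unfolding smooth_on_def using Ck_on_add by blast

lemma smooth_on_scaleR:
  "open U \<Longrightarrow> smooth_on U r \<Longrightarrow> smooth_on U f \<Longrightarrow> smooth_on U (\<lambda>x. r x *\<^sub>R f x)"
  unfolding smooth_on_def using Ck_on_scaleR by blast

lemma smooth_on_compose:
  fixes f :: "'a::euclidean_space \<Rightarrow> 'b::euclidean_space"
  shows "open U \<Longrightarrow> smooth_on U f \<Longrightarrow> smooth_on V h \<Longrightarrow> f ` U \<subseteq> V \<Longrightarrow> smooth_on U (h \<circ> f)"
  unfolding smooth_on_def using Ck_on_compose by blast

lemma smooth_on_differentiable: "smooth_on U f \<Longrightarrow> x \<in> U \<Longrightarrow> f differentiable at x"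
  unfolding smooth_on_def using Ck_on.simps(2) by blast

lemma smooth_on_frechet: "smooth_on U f \<Longrightarrow> smooth_on U (\<lambda>x. frechet_derivative f (at x) v)"
  unfolding smooth_on_def using Ck_on.simps(2) by blast

lemma smooth_on_continuous: "smooth_on U f \<Longrightarrow> continuous_on U f"
  unfolding smooth_on_def using Ck_on.simps(1) by blast

text \<open>The mean value theorem, applied to the second difference of \<open>f\<close> first in the direction
  \<open>u\<close> and then in the direction \<open>v\<close>. The left-hand side is symmetric in \<open>u\<close> and \<open>v\<close>, which
  is what makes mixed derivatives commute.\<close>

lemma second_difference_mean_value:
  fixes f :: "'a::euclidean_space \<Rightarrow> real"
  assumes "smooth_on (ball x r) f" "0 < h" "h * (norm u + norm v) < r"
  shows "\<exists>y\<in>ball x r. f (x + h *\<^sub>R u + h *\<^sub>R v) - f (x + h *\<^sub>R u) - f (x + h *\<^sub>R v) + f x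
    = h * (h * frechet_derivative (\<lambda>y. frechet_derivative f (at y) u) (at y) v)"
proof -
  have in_ball: "x + s *\<^sub>R u + t *\<^sub>R v \<in> ball x r" if "0 \<le> s" "s \<le> h" "0 \<le> t" "t \<le> h" for s t
  proof -
    have "norm (s *\<^sub>R u + t *\<^sub>R v) \<le> s * norm u + t * norm v"
      using norm_triangle_ineq[of "s *\<^sub>R u" "t *\<^sub>R v"] that by simp
    also have "\<dots> \<le> h * norm u + h * norm v"
      using that by (intro add_mono mult_right_mono) auto
    finally have "norm (s *\<^sub>R u + t *\<^sub>R v) < r"
      using assms(3) by (simp add: algebra_simps)
    moreover have "dist x (x + s *\<^sub>R u + t *\<^sub>R v) = norm (s *\<^sub>R u + t *\<^sub>R v)"
      by (metis add.assoc add_diff_cancel_left' dist_norm norm_minus_commute)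
    ultimately show ?thesis by (simp only: mem_ball)
  qed
  \<comment> \<open>The derivative of a smooth function along a line inside the ball.\<close>
  have line: "((\<lambda>s. k (a + s *\<^sub>R w)) has_real_derivative
      frechet_derivative k (at (a + s *\<^sub>R w)) w) (at s)"
    if "smooth_on (ball x r) k" "a + s *\<^sub>R w \<in> ball x r" for k :: "'a \<Rightarrow> real" and a w s
  proof -
    have d: "(k has_derivative frechet_derivative k (at (a + s *\<^sub>R w))) (at (a + s *\<^sub>R w))"
      using smooth_on_differentiable[OF that] frechet_derivative_works by blast
    have "((\<lambda>s. k (a + s *\<^sub>R w)) has_derivative
        (\<lambda>t. frechet_derivative k (at (a + s *\<^sub>R w)) (t *\<^sub>R w))) (at s)"
      by (rule has_derivative_compose[where f = "\<lambda>s. a + s *\<^sub>R w", OF _ d])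
        (auto intro!: derivative_eq_intros)
    moreover have "(\<lambda>t. frechet_derivative k (at (a + s *\<^sub>R w)) (t *\<^sub>R w))
        = (*) (frechet_derivative k (at (a + s *\<^sub>R w)) w)"
      using linear_scale[OF has_derivative_linear[OF d]] by (auto simp: mult.commute)
    ultimately show ?thesis
      unfolding has_field_derivative_def by simp
  qed
  let ?k = "\<lambda>s. f ((x + h *\<^sub>R v) + s *\<^sub>R u) - f (x + s *\<^sub>R u)"
  let ?D = "\<lambda>y. frechet_derivative f (at y) u"
  have k: "(?k has_real_derivative ?D ((x + h *\<^sub>R v) + s *\<^sub>R u) - ?D (x + s *\<^sub>R u)) (at s)"
    if "0 \<le> s" "s \<le> h" for s
    using in_ball[of s h] in_ball[of s 0] that assms(2)
    by (intro DERIV_diff line[OF assms(1)]) (auto simp: add_ac)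
  obtain \<xi> where \<xi>: "0 < \<xi>" "\<xi> < h"
    "?k h - ?k 0 = (h - 0) * (?D ((x + h *\<^sub>R v) + \<xi> *\<^sub>R u) - ?D (x + \<xi> *\<^sub>R u))"
    using MVT2[of 0 h ?k, OF assms(2) k] by blast
  let ?m = "\<lambda>t. ?D ((x + \<xi> *\<^sub>R u) + t *\<^sub>R v)"
  have m: "(?m has_real_derivative
      frechet_derivative ?D (at ((x + \<xi> *\<^sub>R u) + t *\<^sub>R v)) v) (at t)"
    if "0 \<le> t" "t \<le> h" for t
    using in_ball[of \<xi> t] that \<xi>(1,2)
    by (intro line[OF smooth_on_frechet[OF assms(1)]]) auto
  obtain \<eta> where \<eta>: "0 < \<eta>" "\<eta> < h"
    "?m h - ?m 0 = (h - 0) * frechet_derivative ?D (at ((x + \<xi> *\<^sub>R u) + \<eta> *\<^sub>R v)) v"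
    using MVT2[of 0 h ?m, OF assms(2) m] by blast
  have "?k h - ?k 0 = h * (h * frechet_derivative ?D (at ((x + \<xi> *\<^sub>R u) + \<eta> *\<^sub>R v)) v)"
    using \<xi>(3) \<eta>(3) by (simp add: add_ac)
  then show ?thesis
    using in_ball[of \<xi> \<eta>] \<xi>(1,2) \<eta>(1,2)
    by (intro bexI[of _ "(x + \<xi> *\<^sub>R u) + \<eta> *\<^sub>R v"]) (auto simp: add_ac)
qed

text \<open>On arbitrarily small squares the two mixed derivatives take a common value, at possibly
  different points; continuity then gives equality at the corner.\<close>

lemma mixed_derivatives_commute_real:
  fixes f :: "'a::euclidean_space \<Rightarrow> real"
  assumes "open U" "x \<in> U" "smooth_on U f"
  shows "frechet_derivative (\<lambda>y. frechet_derivative f (at y) u) (at x) v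
    = frechet_derivative (\<lambda>y. frechet_derivative f (at y) v) (at x) u"
proof -
  let ?A = "\<lambda>y. frechet_derivative (\<lambda>y. frechet_derivative f (at y) u) (at y) v"
  let ?B = "\<lambda>y. frechet_derivative (\<lambda>y. frechet_derivative f (at y) v) (at y) u"
  have cont: "isCont ?A x" "isCont ?B x"
    using smooth_on_continuous[OF smooth_on_frechet[OF smooth_on_frechet[OF assms(3)]]]
      continuous_on_eq_continuous_at[OF assms(1)] assms(2) by auto
  have small: "\<bar>?A x - ?B x\<bar> < e" if "e > 0" for e
  proof -
    have "0 < e / 2"
      using that by simp
    then obtain r1 r2 where r: "r1 > 0" "r2 > 0"
      "\<And>y. dist y x < r1 \<Longrightarrow> dist (?A y) (?A x) < e / 2"
      "\<And>y. dist y x < r2 \<Longrightarrow> dist (?B y) (?B x) < e / 2"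
      using cont unfolding continuous_at_eps_delta by metis
    obtain r0 where r0: "r0 > 0" "ball x r0 \<subseteq> U"
      using assms(1,2) open_contains_ball by blast
    define r where "r = min r0 (min r1 r2)"
    have r_pos: "r > 0" using r r0 by (simp add: r_def)
    have smooth: "smooth_on (ball x r) f"
      by (rule smooth_on_subset[OF assms(3)]) (use r0 in \<open>auto simp: r_def\<close>)
    \<comment> \<open>The summand 1 in the denominator covers the case that both directions vanish.\<close>
    define h where "h = r / (norm u + norm v + 1)"
    have den: "norm u + norm v + 1 > 0"
      by (simp add: add_nonneg_pos)
    have h: "h > 0" "h * (norm u + norm v) < r"
      using r_pos den by (auto simp: h_def field_simps)
    obtain y where y: "y \<in> ball x r"
      "f (x + h *\<^sub>R u + h *\<^sub>R v) - f (x + h *\<^sub>R u) - f (x + h *\<^sub>R v) + f x = h * (h * ?A y)"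
      using second_difference_mean_value[OF smooth h] by blast
    have h': "h * (norm v + norm u) < r"
      using h(2) by (simp add: add.commute)
    obtain z where z: "z \<in> ball x r"
      "f (x + h *\<^sub>R v + h *\<^sub>R u) - f (x + h *\<^sub>R v) - f (x + h *\<^sub>R u) + f x = h * (h * ?B z)"
      using second_difference_mean_value[OF smooth h(1) h'] by blast
    have "f (x + h *\<^sub>R v + h *\<^sub>R u) = f (x + h *\<^sub>R u + h *\<^sub>R v)"
      by (simp add: add_ac)
    then have "h * (h * ?A y) = h * (h * ?B z)"
      using y(2) z(2) by linarith
    then have "?A y = ?B z"
      using h(1) by simp
    moreover have "dist (?A y) (?A x) < e / 2" "dist (?B z) (?B x) < e / 2"
      using r(3)[of y] r(4)[of z] y(1) z(1) by (auto simp: r_def dist_commute)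
    ultimately show ?thesis
      by (simp add: dist_real_def abs_if split: if_splits)
  qed
  show ?thesis
  proof (rule ccontr)
    assume "?A x \<noteq> ?B x"
    then show False
      using small[of "\<bar>?A x - ?B x\<bar>"] by simp
  qed
qed

lemma mixed_derivatives_commute:
  fixes f :: "'a::euclidean_space \<Rightarrow> 'b::euclidean_space"
  assumes "open U" "x \<in> U" "smooth_on U f"
  shows "frechet_derivative (\<lambda>y. frechet_derivative f (at y) u) (at x) v
    = frechet_derivative (\<lambda>y. frechet_derivative f (at y) v) (at x) u"
proof (rule euclidean_eqI)
  fix b :: 'b
  have inner: "frechet_derivative (\<lambda>y. k y \<bullet> b) (at y) w = frechet_derivative k (at y) w \<bullet> b"
    if "smooth_on U k" "y \<in> U" for k :: "'a \<Rightarrow> 'b" and y w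
  proof -
    have "(k has_derivative frechet_derivative k (at y)) (at y)"
      using smooth_on_differentiable[OF that] frechet_derivative_works by blast
    then show ?thesis
      by (intro frechet_derivative_eqI has_derivative_inner_left)
  qed
  have "frechet_derivative (\<lambda>y. frechet_derivative f (at y) u) (at x) v \<bullet> b
      = frechet_derivative (\<lambda>y. frechet_derivative (\<lambda>y. f y \<bullet> b) (at y) u) (at x) v" for u v
    unfolding inner[OF smooth_on_frechet[OF assms(3)] assms(2), symmetric]
    by (intro fun_cong[OF frechet_derivative_cong_open[OF assms(1,2)]])
      (simp add: inner[OF assms(3)])
  then show "frechet_derivative (\<lambda>y. frechet_derivative f (at y) u) (at x) v \<bullet> b
      = frechet_derivative (\<lambda>y. frechet_derivative f (at y) v) (at x) u \<bullet> b"
    using mixed_derivatives_commute_real[OF assms(1,2)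
        smooth_on_linear[OF bounded_linear_inner_left assms(1,3)]] by metis
qed

text \<open>The product rule for a derivative evaluated on a moving vector.\<close>

lemma has_derivative_frechet_apply:
  fixes f :: "'a::euclidean_space \<Rightarrow> 'b::euclidean_space" and u :: "'a \<Rightarrow> 'a"
  assumes "open U" "x \<in> U" "smooth_on U f" "u differentiable at x"
  shows "((\<lambda>y. frechet_derivative f (at y) (u y)) has_derivative
    (\<lambda>w. frechet_derivative (\<lambda>y. frechet_derivative f (at y) (u x)) (at x) w
        + frechet_derivative f (at x) (frechet_derivative u (at x) w))) (at x)"
proof -
  have lin: "linear (frechet_derivative f (at y))" if "y \<in> U" for y
    using smooth_on_differentiable[OF assms(3) that] linear_frechet_derivative by blast
  let ?D = "\<lambda>b y. frechet_derivative f (at y) b"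
  have D: "(?D b has_derivative frechet_derivative (?D b) (at x)) (at x)" for b
    using smooth_on_differentiable[OF smooth_on_frechet[OF assms(3)] assms(2)]
      frechet_derivative_works by blast
  have u: "(u has_derivative frechet_derivative u (at x)) (at x)"
    using assms(4) frechet_derivative_works by blast
  have "((\<lambda>y. \<Sum>b\<in>Basis. (u y \<bullet> b) *\<^sub>R ?D b y) has_derivative
      (\<lambda>w. \<Sum>b\<in>Basis. (u x \<bullet> b) *\<^sub>R frechet_derivative (?D b) (at x) w
        + (frechet_derivative u (at x) w \<bullet> b) *\<^sub>R ?D b x)) (at x)"
    by (intro has_derivative_sum has_derivative_scaleR has_derivative_inner_left u D)
  moreover have "(\<Sum>b\<in>Basis. (u x \<bullet> b) *\<^sub>R frechet_derivative (?D b) (at x) w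
        + (frechet_derivative u (at x) w \<bullet> b) *\<^sub>R ?D b x)
      = frechet_derivative (?D (u x)) (at x) w + ?D (frechet_derivative u (at x) w) x" for w
  proof -
    have "((\<lambda>y. \<Sum>b\<in>Basis. (u x \<bullet> b) *\<^sub>R ?D b y) has_derivative
        (\<lambda>w. \<Sum>b\<in>Basis. (u x \<bullet> b) *\<^sub>R frechet_derivative (?D b) (at x) w)) (at x)"
      by (intro has_derivative_sum has_derivative_scaleR_right D)
    then have "(?D (u x) has_derivative
        (\<lambda>w. \<Sum>b\<in>Basis. (u x \<bullet> b) *\<^sub>R frechet_derivative (?D b) (at x) w)) (at x)"
      by (rule has_derivative_transform_within_open[OF _ assms(1,2)])
        (simp add: linear_eq_sum_Basis[OF lin, symmetric])
    then show ?thesis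
      by (simp add: sum.distrib frechet_derivative_eqI linear_eq_sum_Basis[OF lin[OF assms(2)], symmetric])
  qed
  ultimately have "((\<lambda>y. \<Sum>b\<in>Basis. (u y \<bullet> b) *\<^sub>R ?D b y) has_derivative
      (\<lambda>w. frechet_derivative (?D (u x)) (at x) w + ?D (frechet_derivative u (at x) w) x)) (at x)"
    by simp
  then show ?thesis
    by (rule has_derivative_transform_within_open[OF _ assms(1,2)])
      (simp add: linear_eq_sum_Basis[OF lin, symmetric])
qed


section \<open>Charts and directional derivatives\<close>

definition transition_deriv ::
  "('m, 'e::euclidean_space) chart \<Rightarrow> ('m, 'e) chart \<Rightarrow> 'm \<Rightarrow> 'e \<Rightarrow> 'e" where
  "transition_deriv c c' q = frechet_derivative (snd c' \<circ> chart_inv c) (at (snd c q))"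

text \<open>Components and coordinate fields are the transitions from and to the distinguished chart, so
  their algebra is the chain rule for transition maps.\<close>

lemma components_eq_transition_deriv:
  "components M c q v = transition_deriv (chart_at M q) c q v"
  unfolding components_def dir_deriv_def transition_deriv_def ..

lemma coord_field_eq_transition_deriv:
  "coord_field M c v q = transition_deriv c (chart_at M q) q v"
  unfolding coord_field_def transition_deriv_def ..

text \<open>The relational form of \<^const>\<open>dir_deriv\<close>: it also asserts that the derivative exists, which
  the rules of differentiation need.\<close>

definition has_dir_deriv ::
  "('m, 'e::euclidean_space) atlas \<Rightarrow> ('m \<Rightarrow> 'b::real_normed_vector) \<Rightarrow> ('e \<Rightarrow> 'b) \<Rightarrow> 'm \<Rightarrow> bool"
  where
  "has_dir_deriv M h D p \<longleftrightarrow>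
     ((h \<circ> chart_inv (chart_at M p)) has_derivative D) (at (snd (chart_at M p) p))"

lemma dir_deriv_eq: "has_dir_deriv M h D p \<Longrightarrow> dir_deriv M h p v = D v"
  unfolding has_dir_deriv_def dir_deriv_def by (rule frechet_derivative_eqI)

lemma has_dir_deriv_const: "has_dir_deriv M (\<lambda>q. a) (\<lambda>v. 0) p"
  unfolding has_dir_deriv_def comp_def by simp

lemma has_dir_deriv_linear:
  "bounded_linear A \<Longrightarrow> has_dir_deriv M h D p \<Longrightarrow>
    has_dir_deriv M (\<lambda>q. A (h q)) (\<lambda>v. A (D v)) p"
  unfolding has_dir_deriv_def comp_def by (rule bounded_linear.has_derivative)

lemma has_dir_deriv_sum:
  "(\<And>i. i \<in> I \<Longrightarrow> has_dir_deriv M (h i) (D i) p) \<Longrightarrow>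
    has_dir_deriv M (\<lambda>q. \<Sum>i\<in>I. h i q) (\<lambda>v. \<Sum>i\<in>I. D i v) p"
  unfolding has_dir_deriv_def comp_def by (rule has_derivative_sum)

locale smooth_atlas =
  fixes M :: "('m::{t2_space, second_countable_topology}, 'e::euclidean_space) atlas"
  assumes smooth_manifold: "smooth_manifold M"
begin

lemma chart_at: "chart_at M p \<in> M" "p \<in> fst (chart_at M p)"
proof -
  have "\<exists>c. c \<in> M \<and> p \<in> fst c"
    using smooth_manifold unfolding smooth_manifold_def by blast
  then show "chart_at M p \<in> M" "p \<in> fst (chart_at M p)"
    using someI_ex[of "\<lambda>c. c \<in> M \<and> p \<in> fst c"] unfolding chart_at_def by auto
qed

lemma chart_homeomorphism:
  "c \<in> M \<Longrightarrow> homeomorphism (fst c) (snd c ` fst c) (snd c) (chart_inv c)"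
  and open_domain: "c \<in> M \<Longrightarrow> open (fst c)"
  and open_range: "c \<in> M \<Longrightarrow> open (snd c ` fst c)"
  and smooth_transition: "c \<in> M \<Longrightarrow> c' \<in> M \<Longrightarrow>
    smooth_on (snd c ` (fst c \<inter> fst c')) (snd c' \<circ> chart_inv c)"
  using smooth_manifold unfolding smooth_manifold_def by auto

lemma chart_inv_chart: "c \<in> M \<Longrightarrow> q \<in> fst c \<Longrightarrow> chart_inv c (snd c q) = q"
  using chart_homeomorphism[of c] homeomorphism_apply1 by blast

lemma open_chart_image:
  assumes "c \<in> M" "open V"
  shows "open (snd c ` (fst c \<inter> V))"
proof -
  have "snd c ` (fst c \<inter> V) = chart_inv c -` V \<inter> snd c ` fst c"
    using chart_inv_chart[OF assms(1)] by (auto intro!: rev_image_eqI)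
  moreover have "continuous_on (snd c ` fst c) (chart_inv c)"
    using chart_homeomorphism[OF assms(1)] homeomorphism_cont2 by blast
  ultimately show ?thesis
    using assms(2) open_range[OF assms(1)] continuous_on_open_vimage by metis
qed

lemma open_chart_overlap: "c \<in> M \<Longrightarrow> c' \<in> M \<Longrightarrow> open (snd c ` (fst c \<inter> fst c'))"
  using open_chart_image open_domain by blast

lemma transition_has_derivative:
  assumes "c \<in> M" "c' \<in> M" "q \<in> fst c" "q \<in> fst c'"
  shows "((snd c' \<circ> chart_inv c) has_derivative transition_deriv c c' q) (at (snd c q))"
proof -
  have "(snd c' \<circ> chart_inv c) differentiable at (snd c q)"
    by (rule smooth_on_differentiable[OF smooth_transition[OF assms(1,2)]]) (use assms in blast)
  then show ?thesis
    unfolding transition_deriv_def using frechet_derivative_works by blast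
qed

lemma linear_transition_deriv:
  "c \<in> M \<Longrightarrow> c' \<in> M \<Longrightarrow> q \<in> fst c \<Longrightarrow> q \<in> fst c' \<Longrightarrow> linear (transition_deriv c c' q)"
  using transition_has_derivative has_derivative_linear by blast

lemma has_derivative_change_chart:
  assumes "c \<in> M" "c' \<in> M" "q \<in> fst c" "q \<in> fst c'"
    and "((h \<circ> chart_inv c) has_derivative D) (at (snd c q))"
  shows "((h \<circ> chart_inv c') has_derivative (\<lambda>v. D (transition_deriv c' c q v))) (at (snd c' q))"
proof -
  have "((h \<circ> chart_inv c) has_derivative D) (at ((snd c \<circ> chart_inv c') (snd c' q)))"
    using assms chart_inv_chart by simp
  then have "(((h \<circ> chart_inv c) \<circ> (snd c \<circ> chart_inv c')) has_derivative
      (D \<circ> transition_deriv c' c q)) (at (snd c' q))"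
    using diff_chain_at[OF transition_has_derivative[OF assms(2,1,4,3)]] by blast
  then have "((h \<circ> chart_inv c') has_derivative (D \<circ> transition_deriv c' c q)) (at (snd c' q))"
    by (rule has_derivative_transform_within_open[OF _ open_chart_overlap[OF assms(2,1)]])
      (use assms(3,4) chart_inv_chart[OF assms(1)] chart_inv_chart[OF assms(2)] in auto)
  then show ?thesis by (simp add: comp_def)
qed

lemma transition_deriv_comp:
  assumes "c1 \<in> M" "c2 \<in> M" "c3 \<in> M" "q \<in> fst c1" "q \<in> fst c2" "q \<in> fst c3"
  shows "transition_deriv c2 c3 q (transition_deriv c1 c2 q v) = transition_deriv c1 c3 q v"
  using frechet_derivative_eqI[OF has_derivative_change_chart[OF assms(2,1,5,4)
        transition_has_derivative[OF assms(2,3,5,6)]]]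
  unfolding transition_deriv_def by simp

lemma transition_deriv_refl:
  assumes "c \<in> M" "q \<in> fst c"
  shows "transition_deriv c c q v = v"
proof -
  have "((snd c \<circ> chart_inv c) has_derivative (\<lambda>v. v)) (at (snd c q))"
    by (rule has_derivative_transform_within_open[OF has_derivative_ident open_range[OF assms(1)]])
      (use assms(2) chart_inv_chart[OF assms(1)] in auto)
  then show ?thesis
    unfolding transition_deriv_def by (rule frechet_derivative_eqI)
qed

lemma components_chart_at: "components M (chart_at M p) p v = v"
  unfolding components_eq_transition_deriv using transition_deriv_refl chart_at by blast

lemma coord_field_chart_at: "coord_field M (chart_at M p) v p = v"
  unfolding coord_field_eq_transition_deriv using transition_deriv_refl chart_at by blast

lemma components_coord_field:
  assumes "c \<in> M" "q \<in> fst c"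
  shows "components M c q (coord_field M c v q) = v"
  unfolding components_eq_transition_deriv coord_field_eq_transition_deriv
  using transition_deriv_comp[of c "chart_at M q" c q] transition_deriv_refl assms chart_at by simp

lemma coord_field_components:
  assumes "c \<in> M" "q \<in> fst c"
  shows "coord_field M c (components M c q v) q = v"
  unfolding components_eq_transition_deriv coord_field_eq_transition_deriv
  using transition_deriv_comp[of "chart_at M q" c "chart_at M q" q] transition_deriv_refl assms
    chart_at by simp

lemma linear_components: "c \<in> M \<Longrightarrow> q \<in> fst c \<Longrightarrow> linear (components M c q)"
  using linear_transition_deriv[OF chart_at(1) _ chart_at(2)]
  unfolding components_eq_transition_deriv by metis

lemma linear_coord_field: "c \<in> M \<Longrightarrow> q \<in> fst c \<Longrightarrow> linear (\<lambda>v. coord_field M c v q)"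
  using linear_transition_deriv[OF _ chart_at(1) _ chart_at(2)]
  unfolding coord_field_eq_transition_deriv by metis

lemma has_dir_derivI_smooth:
  assumes "smooth_fun_on M U h" "open U" "p \<in> U"
  shows "has_dir_deriv M h (dir_deriv M h p) p"
proof -
  have "(h \<circ> chart_inv (chart_at M p)) differentiable at (snd (chart_at M p) p)"
    by (rule smooth_on_differentiable[of "snd (chart_at M p) ` (fst (chart_at M p) \<inter> U)"])
      (use assms chart_at in \<open>auto simp: smooth_fun_on_def\<close>)
  then show ?thesis
    unfolding has_dir_deriv_def dir_deriv_def[abs_def] using frechet_derivative_works by blast
qed

lemma has_dir_deriv_cong:
  assumes "has_dir_deriv M h D p" "open U" "p \<in> U" "\<And>q. q \<in> U \<Longrightarrow> h q = k q"
  shows "has_dir_deriv M k D p"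
  unfolding has_dir_deriv_def
  by (rule has_derivative_transform_within_open[OF
        assms(1)[unfolded has_dir_deriv_def] open_chart_image[OF chart_at(1) assms(2)]])
    (use assms(3,4) chart_at chart_inv_chart[OF chart_at(1)] in auto)

lemma dir_deriv_cong:
  assumes "open U" "p \<in> U" "\<And>q. q \<in> U \<Longrightarrow> h q = k q"
  shows "dir_deriv M h p v = dir_deriv M k p v"
  unfolding dir_deriv_def
  by (intro fun_cong[OF frechet_derivative_cong_open[OF open_chart_image[OF chart_at(1) assms(1)]]])
    (use assms(2,3) chart_at chart_inv_chart[OF chart_at(1)] in auto)

lemma has_dir_deriv_scaleR:
  fixes r :: "'m \<Rightarrow> real"
  assumes "has_dir_deriv M r D p" "has_dir_deriv M h E p"
  shows "has_dir_deriv M (\<lambda>q. r q *\<^sub>R h q) (\<lambda>v. r p *\<^sub>R E v + D v *\<^sub>R h p) p"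
  using has_derivative_scaleR[OF assms[unfolded has_dir_deriv_def]]
    chart_inv_chart[OF chart_at] by (simp add: has_dir_deriv_def comp_def)

lemma has_dir_deriv_chart:
  "c \<in> M \<Longrightarrow> p \<in> fst c \<Longrightarrow> has_dir_deriv M (snd c) (components M c p) p"
  using transition_has_derivative[OF chart_at(1) _ chart_at(2)]
  unfolding has_dir_deriv_def components_eq_transition_deriv[abs_def] by blast


section \<open>Smooth vector fields\<close>

lemma smooth_fun_on_cong:
  assumes "open U" "smooth_fun_on M U h" "\<And>q. q \<in> U \<Longrightarrow> h q = k q"
  shows "smooth_fun_on M U k"
  unfolding smooth_fun_on_def
proof
  fix c assume c: "c \<in> M"
  show "smooth_on (snd c ` (fst c \<inter> U)) (k \<circ> chart_inv c)"
    by (rule smooth_on_cong[OF open_chart_image[OF c assms(1)], of "h \<circ> chart_inv c"])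
      (use assms(2,3) c chart_inv_chart[OF c] in \<open>auto simp: smooth_fun_on_def\<close>)
qed

lemma smooth_fun_on_linear:
  assumes "open U" "smooth_fun_on M U h" "bounded_linear A"
  shows "smooth_fun_on M U (\<lambda>q. A (h q))"
  using assms smooth_on_linear[OF assms(3) open_chart_image[OF _ assms(1)]]
  unfolding smooth_fun_on_def comp_def by blast

lemma smooth_fun_on_const: "smooth_fun_on M U (\<lambda>q. a)"
  unfolding smooth_fun_on_def comp_def by (simp add: smooth_on_const)

lemma smooth_fun_on_subset: "smooth_fun_on M U h \<Longrightarrow> V \<subseteq> U \<Longrightarrow> smooth_fun_on M V h"
  unfolding smooth_fun_on_def by (blast intro: smooth_on_subset)

lemma smooth_vector_field_add:
  assumes "open U" "smooth_vector_field_on M U X" "smooth_vector_field_on M U Y"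
  shows "smooth_vector_field_on M U (\<lambda>q. X q + Y q)"
  unfolding smooth_vector_field_on_def
proof
  fix c assume c: "c \<in> M"
  have op: "open (U \<inter> fst c)"
    using assms(1) open_domain[OF c] by blast
  have "smooth_fun_on M (U \<inter> fst c) (\<lambda>q. components M c q (X q) + components M c q (Y q))"
    using assms c smooth_on_add[OF open_chart_image[OF _ op]]
    unfolding smooth_fun_on_def smooth_vector_field_on_def comp_def by blast
  then show "smooth_fun_on M (U \<inter> fst c) (\<lambda>q. components M c q (X q + Y q))"
    by (rule smooth_fun_on_cong[OF op]) (use c in \<open>simp add: linear_add[OF linear_components]\<close>)
qed

lemma smooth_vector_field_scaleR:
  assumes "open U" "smooth_fun_on M U r" "smooth_vector_field_on M U X"
  shows "smooth_vector_field_on M U (\<lambda>q. r q *\<^sub>R X q)"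
  unfolding smooth_vector_field_on_def
proof
  fix c assume c: "c \<in> M"
  have op: "open (U \<inter> fst c)"
    using assms(1) open_domain[OF c] by blast
  have "smooth_fun_on M (U \<inter> fst c) r"
    by (rule smooth_fun_on_subset[OF assms(2)]) blast
  then have "smooth_fun_on M (U \<inter> fst c) (\<lambda>q. r q *\<^sub>R components M c q (X q))"
    using assms(3) c smooth_on_scaleR[OF open_chart_image[OF _ op]]
    unfolding smooth_fun_on_def smooth_vector_field_on_def comp_def by blast
  then show "smooth_fun_on M (U \<inter> fst c) (\<lambda>q. components M c q (r q *\<^sub>R X q))"
    by (rule smooth_fun_on_cong[OF op]) (use c in \<open>simp add: linear_scale[OF linear_components]\<close>)
qed

text \<open>In another chart the components of a coordinate field are a directional derivative of the
  transition map.\<close>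

lemma smooth_coord_field:
  assumes c: "c \<in> M"
  shows "smooth_vector_field_on M (fst c) (coord_field M c v)"
  unfolding smooth_vector_field_on_def
proof
  fix c' assume c': "c' \<in> M"
  have op: "open (fst c \<inter> fst c')"
    using open_domain c c' by blast
  let ?h = "\<lambda>q. transition_deriv c c' q v"
  have "smooth_fun_on M (fst c \<inter> fst c') ?h"
    unfolding smooth_fun_on_def
  proof
    fix c'' assume c'': "c'' \<in> M"
    let ?U = "snd c'' ` (fst c'' \<inter> (fst c \<inter> fst c'))"
    let ?D = "\<lambda>x. frechet_derivative (snd c' \<circ> chart_inv c) (at x) v"
    have "smooth_on ?U (?D \<circ> (snd c \<circ> chart_inv c''))"
    proof (rule smooth_on_compose[OF open_chart_image[OF c'' op]])
      show "smooth_on ?U (snd c \<circ> chart_inv c'')"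
        by (rule smooth_on_subset[OF smooth_transition[OF c'' c]]) blast
      show "smooth_on (snd c ` (fst c \<inter> fst c')) ?D"
        by (rule smooth_on_frechet[OF smooth_transition[OF c c']])
      show "(snd c \<circ> chart_inv c'') ` ?U \<subseteq> snd c ` (fst c \<inter> fst c')"
        using chart_inv_chart[OF c''] by auto
    qed
    then show "smooth_on ?U (?h \<circ> chart_inv c'')"
      by (simp add: transition_deriv_def comp_def)
  qed
  then show "smooth_fun_on M (fst c \<inter> fst c') (\<lambda>q. components M c' q (coord_field M c v q))"
    by (rule smooth_fun_on_cong[OF op])
      (use c c' chart_at transition_deriv_comp in
        \<open>auto simp: components_eq_transition_deriv coord_field_eq_transition_deriv\<close>)
qed

end


section \<open>Affine connections in a chart\<close>

context smooth_atlas
begin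

lemma connection_cong:
  assumes "affine_connection M nabla" "open U" "p \<in> U"
    and "smooth_vector_field_on M U X" "smooth_vector_field_on M U Y"
    and "\<And>q. q \<in> U \<Longrightarrow> Y' q = Y q"
  shows "nabla X Y' p = nabla X Y p"
  by (rule assms(1)[unfolded affine_connection_def, THEN spec[of _ U], THEN spec[of _ X],
        THEN spec[of _ Y], THEN mp, OF conjI[OF assms(2) conjI[OF assms(4,5)]],
        THEN conjunct2, THEN conjunct1, rule_format, OF _ assms(3)]) (simp add: assms(6))

lemma connection_add:
  assumes "affine_connection M nabla" "open U" "p \<in> U"
    and "smooth_vector_field_on M U X" "smooth_vector_field_on M U Y" "smooth_vector_field_on M U Y'"
  shows "nabla X (\<lambda>q. Y q + Y' q) p = nabla X Y p + nabla X Y' p"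
  by (rule assms(1)[unfolded affine_connection_def, THEN spec[of _ U], THEN spec[of _ X],
        THEN spec[of _ Y], THEN mp, OF conjI[OF assms(2) conjI[OF assms(4,5)]],
        THEN conjunct2, THEN conjunct2, THEN conjunct2, THEN conjunct1, rule_format, OF assms(6,3)])

lemma connection_scaleR:
  assumes "affine_connection M nabla" "open U" "p \<in> U"
    and "smooth_vector_field_on M U X" "smooth_vector_field_on M U Y" "smooth_fun_on M U r"
  shows "nabla X (\<lambda>q. r q *\<^sub>R Y q) p = dir_deriv M r p (X p) *\<^sub>R Y p + r p *\<^sub>R nabla X Y p"
  by (rule assms(1)[unfolded affine_connection_def, THEN spec[of _ U], THEN spec[of _ X],
        THEN spec[of _ Y], THEN mp, OF conjI[OF assms(2) conjI[OF assms(4,5)]],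
        THEN conjunct2, THEN conjunct2, THEN conjunct2, THEN conjunct2, rule_format, OF assms(6,3), THEN conjunct2])

text \<open>Smoothness of the sum is part of the conclusion because additivity of a connection is
  available for smooth fields only, so the induction has to carry it along.\<close>

lemma connection_sum:
  assumes con: "affine_connection M nabla" and U: "open U" "p \<in> U"
    and X: "smooth_vector_field_on M U X" and "finite I"
    and "\<And>i. i \<in> I \<Longrightarrow> smooth_fun_on M U (r i)"
    and "\<And>i. i \<in> I \<Longrightarrow> smooth_vector_field_on M U (Y i)"
  shows "smooth_vector_field_on M U (\<lambda>q. \<Sum>i\<in>I. r i q *\<^sub>R Y i q) \<and>
    nabla X (\<lambda>q. \<Sum>i\<in>I. r i q *\<^sub>R Y i q) p =
    (\<Sum>i\<in>I. dir_deriv M (r i) p (X p) *\<^sub>R Y i p + r i p *\<^sub>R nabla X (Y i) p)"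
  using assms(5-)
proof (induction I)
  case empty
  have "dir_deriv M (\<lambda>q. 0::real) p (X p) = 0"
    using dir_deriv_eq[OF has_dir_deriv_const] .
  then show ?case
    using smooth_vector_field_scaleR[OF U(1) smooth_fun_on_const[of U 0] X]
      connection_scaleR[OF con U X X smooth_fun_on_const[of U 0]] by simp
next
  case (insert i I)
  have i: "smooth_vector_field_on M U (\<lambda>q. r i q *\<^sub>R Y i q)"
    using insert.prems by (intro smooth_vector_field_scaleR[OF U(1)]) auto
  have I: "smooth_vector_field_on M U (\<lambda>q. \<Sum>i\<in>I. r i q *\<^sub>R Y i q)"
    using insert by auto
  have "nabla X (\<lambda>q. r i q *\<^sub>R Y i q) p
      = dir_deriv M (r i) p (X p) *\<^sub>R Y i p + r i p *\<^sub>R nabla X (Y i) p"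
    using insert.prems by (intro connection_scaleR[OF con U X]) auto
  then show ?case
    using insert smooth_vector_field_add[OF U(1) i I] connection_add[OF con U X i I] by simp
qed

lemma linear_connection_coord_field:
  assumes con: "affine_connection M nabla" and c: "c \<in> M" "p \<in> fst c"
    and X: "smooth_vector_field_on M (fst c) X"
  shows "linear (\<lambda>v. nabla X (coord_field M c v) p)"
proof (rule linearI)
  note op = open_domain[OF c(1)] c(2)
  note lin = linear_coord_field[OF c(1)]
  fix v w :: 'e and a :: real
  show "nabla X (coord_field M c (v + w)) p
      = nabla X (coord_field M c v) p + nabla X (coord_field M c w) p"
    using connection_cong[OF con op X smooth_vector_field_add[OF op(1) smooth_coord_field
          smooth_coord_field, OF c(1) c(1)], of "coord_field M c (v + w)" v w]
      connection_add[OF con op X smooth_coord_field smooth_coord_field, OF c(1) c(1)]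
      linear_add[OF lin] by simp
  have "dir_deriv M (\<lambda>q. a) p (X p) = 0"
    using dir_deriv_eq[OF has_dir_deriv_const] .
  then show "nabla X (coord_field M c (a *\<^sub>R v)) p = a *\<^sub>R nabla X (coord_field M c v) p"
    using connection_cong[OF con op X smooth_vector_field_scaleR[OF op(1) smooth_fun_on_const
          smooth_coord_field[OF c(1)]], of "coord_field M c (a *\<^sub>R v)" a v]
      connection_scaleR[OF con op X smooth_coord_field[OF c(1)] smooth_fun_on_const]
      linear_scale[OF lin] by simp
qed

lemma has_dir_deriv_components:
  assumes "c \<in> M" "p \<in> fst c" "smooth_vector_field_on M (fst c) Y"
  shows "has_dir_deriv M (\<lambda>q. components M c q (Y q))
    (dir_deriv M (\<lambda>q. components M c q (Y q)) p) p"
  by (rule has_dir_derivI_smooth[of "fst c"])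
    (use assms open_domain in \<open>auto simp: smooth_vector_field_on_def\<close>)

text \<open>The Leibniz rule in the coordinate frame: only the components of \<open>Y\<close> are
  differentiated, and the rest is the connection of a field with constant components.\<close>

lemma connection_in_chart:
  assumes con: "affine_connection M nabla"
    and X: "smooth_vector_field_on M (fst (chart_at M p)) X"
    and Y: "smooth_vector_field_on M (fst (chart_at M p)) Y"
  shows "nabla X Y p = dir_deriv M (\<lambda>q. components M (chart_at M p) q (Y q)) p (X p)
    + nabla X (coord_field M (chart_at M p) (Y p)) p"
proof -
  define c where "c = chart_at M p"
  have c: "c \<in> M" "p \<in> fst c"
    using chart_at unfolding c_def by auto
  note op = open_domain[OF c(1)] c(2)
  let ?y = "\<lambda>q. components M c q (Y q)"
  have y: "smooth_fun_on M (fst c) ?y"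
    using Y c unfolding smooth_vector_field_on_def c_def by auto
  have r: "smooth_fun_on M (fst c) (\<lambda>q. ?y q \<bullet> b)" for b
    by (rule smooth_fun_on_linear[OF op(1) y bounded_linear_inner_left])
  have d: "dir_deriv M (\<lambda>q. ?y q \<bullet> b) p v = dir_deriv M ?y p v \<bullet> b" for b v
    by (rule dir_deriv_eq[OF has_dir_deriv_linear[OF bounded_linear_inner_left
            has_dir_derivI_smooth[OF y op]]])
  note sum = connection_sum[OF con op X[folded c_def] finite_Basis r smooth_coord_field[OF c(1)]]
  have Y_eq: "Y q = (\<Sum>b\<in>Basis. (?y q \<bullet> b) *\<^sub>R coord_field M c b q)" if "q \<in> fst c" for q
    using linear_eq_sum_Basis[OF linear_coord_field[OF c(1) that], of "?y q"]
      coord_field_components[OF c(1) that] by simp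
  have "nabla X Y p = (\<Sum>b\<in>Basis. dir_deriv M (\<lambda>q. ?y q \<bullet> b) p (X p) *\<^sub>R coord_field M c b p
      + (?y p \<bullet> b) *\<^sub>R nabla X (coord_field M c b) p)"
    using connection_cong[OF con op X[folded c_def] conjunct1[OF sum] Y_eq] conjunct2[OF sum]
    by simp
  also have "\<dots> = (\<Sum>b\<in>Basis. (dir_deriv M ?y p (X p) \<bullet> b) *\<^sub>R b)
      + (\<Sum>b\<in>Basis. (Y p \<bullet> b) *\<^sub>R nabla X (coord_field M c b) p)"
    using coord_field_chart_at[of p] components_chart_at[of p]
    by (simp add: d[unfolded c_def] sum.distrib c_def)
  also have "\<dots> = dir_deriv M ?y p (X p) + nabla X (coord_field M c (Y p)) p"
    using linear_eq_sum_Basis[OF linear_connection_coord_field[OF con c X[folded c_def]], of "Y p"]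
    by (simp add: euclidean_representation)
  finally show ?thesis
    unfolding c_def .
qed

text \<open>Coordinate fields commute, so a torsion-free connection is symmetric on them.\<close>

lemma levi_civita_coord_field_symmetric:
  assumes "levi_civita M g nabla"
  shows "nabla (coord_field M (chart_at M p) v) (coord_field M (chart_at M p) w) p
    = nabla (coord_field M (chart_at M p) w) (coord_field M (chart_at M p) v) p"
proof -
  define c where "c = chart_at M p"
  have c: "c \<in> M" "p \<in> fst c"
    using chart_at unfolding c_def by auto
  have const: "dir_deriv M (\<lambda>q. components M c q (coord_field M c v q)) p u = 0" for u v
    by (rule trans[OF dir_deriv_cong[OF open_domain[OF c(1)] c(2) components_coord_field[OF c(1)]]
          dir_deriv_eq[OF has_dir_deriv_const]])
  have "nabla (coord_field M c v) (coord_field M c w) p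
      - nabla (coord_field M c w) (coord_field M c v) p
      = lie_bracket M (coord_field M c v) (coord_field M c w) p"
    by (rule assms[unfolded levi_civita_def, THEN conjunct2, THEN spec[of _ "fst c"],
        THEN spec[of _ "coord_field M c v"], THEN spec[of _ "coord_field M c w"], THEN mp,
        THEN conjunct1, THEN bspec, OF _ c(2)])
      (intro conjI open_domain[OF c(1)] smooth_coord_field[OF c(1)])
  also have "\<dots> = 0"
    unfolding lie_bracket_def Let_def c_def[symmetric] const by simp
  finally show ?thesis
    unfolding c_def by simp
qed

end


section \<open>Fields along an immersion\<close>

locale smooth_map_between = N: smooth_atlas N + M: smooth_atlas M
  for N :: "('n::{t2_space, second_countable_topology}, 'd::euclidean_space) atlas"
    and M :: "('m::{t2_space, second_countable_topology}, 'e::euclidean_space) atlas" +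
  fixes f :: "'n \<Rightarrow> 'm"
  assumes smooth_map: "smooth_map N M f"
begin

lemma open_vimage_domain: "c \<in> M \<Longrightarrow> open (f -` fst c)"
  using smooth_map M.open_domain open_vimage unfolding smooth_map_def by blast

lemma smooth_chart_comp: "c \<in> M \<Longrightarrow> smooth_fun_on N (f -` fst c) (snd c \<circ> f)"
  using smooth_map unfolding smooth_map_def by blast

lemma has_dir_deriv_chart_at_comp:
  "has_dir_deriv N (snd (chart_at M (f p)) \<circ> f) (differential N M f p) p"
  using N.has_dir_derivI_smooth[OF smooth_chart_comp open_vimage_domain] M.chart_at
  unfolding differential_def[abs_def] by blast

lemma has_dir_deriv_comp:
  assumes "has_dir_deriv M h D (f p)"
  shows "has_dir_deriv N (\<lambda>q. h (f q)) (\<lambda>v. D (differential N M f p v)) p"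
proof -
  define c where "c = chart_at M (f p)"
  define c' where "c' = chart_at N p"
  have c: "c \<in> M" "f p \<in> fst c" and c': "c' \<in> N" "p \<in> fst c'"
    using M.chart_at N.chart_at unfolding c_def c'_def by auto
  have "((h \<circ> chart_inv c) has_derivative D) (at ((snd c \<circ> f \<circ> chart_inv c') (snd c' p)))"
    using assms N.chart_inv_chart[OF c'] by (simp add: has_dir_deriv_def c_def)
  moreover have "((snd c \<circ> f \<circ> chart_inv c') has_derivative differential N M f p) (at (snd c' p))"
    using has_dir_deriv_chart_at_comp[of p] by (simp add: has_dir_deriv_def c_def c'_def)
  ultimately have "((h \<circ> chart_inv c \<circ> (snd c \<circ> f \<circ> chart_inv c')) has_derivative
      (D \<circ> differential N M f p)) (at (snd c' p))"
    using diff_chain_at by blast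
  then have "(((\<lambda>q. h (f q)) \<circ> chart_inv c') has_derivative (D \<circ> differential N M f p))
      (at (snd c' p))"
    by (rule has_derivative_transform_within_open[OF _
          N.open_chart_image[OF c'(1) open_vimage_domain[OF c(1)]]])
      (use c c' M.chart_inv_chart[OF c(1)] N.chart_inv_chart[OF c'(1)] in auto)
  then show ?thesis
    by (simp add: has_dir_deriv_def c'_def comp_def)
qed

lemma linear_differential: "linear (differential N M f p)"
  using has_dir_deriv_chart_at_comp has_derivative_linear unfolding has_dir_deriv_def by blast

lemma components_differential:
  assumes "c \<in> M" "f q \<in> fst c" "c' \<in> N" "q \<in> fst c'"
  shows "components M c (f q) (differential N M f q v)
    = frechet_derivative (snd c \<circ> f \<circ> chart_inv c') (at (snd c' q)) (components N c' q v)"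
proof -
  have "(snd c \<circ> f \<circ> chart_inv c') differentiable at (snd c' q)"
    by (rule smooth_on_differentiable[of "snd c' ` (fst c' \<inter> f -` fst c)"])
      (use assms smooth_chart_comp in \<open>auto simp: smooth_fun_on_def\<close>)
  then have "((snd c \<circ> f \<circ> chart_inv c') has_derivative
      frechet_derivative (snd c \<circ> f \<circ> chart_inv c') (at (snd c' q))) (at (snd c' q))"
    using frechet_derivative_works by blast
  note D = N.has_derivative_change_chart[OF assms(3) N.chart_at(1) assms(4) N.chart_at(2) this]
  have "has_dir_deriv N (\<lambda>q. snd c (f q))
      (\<lambda>v. components M c (f q) (differential N M f q v)) q"
    by (rule has_dir_deriv_comp[OF M.has_dir_deriv_chart[OF assms(1,2)]])
  then have "components M c (f q) (differential N M f q v)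
      = dir_deriv N (snd c \<circ> f) q v"
    using dir_deriv_eq by (metis comp_apply ext)
  also have "\<dots> = frechet_derivative (snd c \<circ> f \<circ> chart_inv c') (at (snd c' q))
      (transition_deriv (chart_at N q) c' q v)"
    unfolding dir_deriv_def by (rule frechet_derivative_eqI[OF D])
  finally show ?thesis
    unfolding components_eq_transition_deriv .
qed

text \<open>In charts, the field \<open>df(U)\<close> along \<open>f\<close> is \<open>x \<mapsto> DF(x) (u x)\<close>; the first summand of its
  derivative is the second derivative of the coordinate representation \<open>F\<close> of \<open>f\<close>.\<close>

lemma has_dir_deriv_differential:
  fixes p
  assumes U: "smooth_vector_field_on N UNIV U"
  defines "F \<equiv> snd (chart_at M (f p)) \<circ> f \<circ> chart_inv (chart_at N p)"
  shows "has_dir_deriv N (\<lambda>q. components M (chart_at M (f p)) (f q) (differential N M f q (U q)))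
    (\<lambda>w. frechet_derivative (\<lambda>x. frechet_derivative F (at x) (U p)) (at (snd (chart_at N p) p)) w
      + differential N M f p (dir_deriv N (\<lambda>q. components N (chart_at N p) q (U q)) p w)) p"
proof -
  define c where "c = chart_at M (f p)"
  define c' where "c' = chart_at N p"
  have c: "c \<in> M" "f p \<in> fst c" and c': "c' \<in> N" "p \<in> fst c'"
    using M.chart_at N.chart_at unfolding c_def c'_def by auto
  have F: "F = snd c \<circ> f \<circ> chart_inv c'"
    unfolding F_def c_def c'_def ..
  let ?V = "snd c' ` (fst c' \<inter> f -` fst c)"
  have op: "open ?V" and V: "snd c' p \<in> ?V"
    using N.open_chart_image[OF c'(1) open_vimage_domain[OF c(1)]] c c' by auto
  have smooth: "smooth_on ?V F"
    using smooth_chart_comp[OF c(1)] c'(1) unfolding F smooth_fun_on_def by blast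
  let ?u = "(\<lambda>q. components N c' q (U q)) \<circ> chart_inv c'"
  have comp: "smooth_fun_on N (fst c') (\<lambda>q. components N c' q (U q))"
    using U c' unfolding smooth_vector_field_on_def by auto
  have u: "(?u has_derivative dir_deriv N (\<lambda>q. components N c' q (U q)) p) (at (snd c' p))"
    using N.has_dir_derivI_smooth[OF comp N.open_domain[OF c'(1)] c'(2)]
    unfolding has_dir_deriv_def c'_def .
  have up: "?u (snd c' p) = U p"
    using N.chart_inv_chart[OF c'] N.components_chart_at[of p] by (simp add: c'_def)
  have du: "frechet_derivative ?u (at (snd c' p)) = dir_deriv N (\<lambda>q. components N c' q (U q)) p"
    using frechet_derivative_at[OF u] by simp
  have dF: "frechet_derivative F (at (snd c' p)) = differential N M f p"
    using has_dir_deriv_chart_at_comp[of p] frechet_derivative_at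
    unfolding has_dir_deriv_def F c_def c'_def by metis
  have "?u differentiable at (snd c' p)"
    using u differentiableI by blast
  from has_derivative_frechet_apply[OF op V smooth this]
  have "((\<lambda>x. frechet_derivative F (at x) (?u x)) has_derivative
      (\<lambda>w. frechet_derivative (\<lambda>x. frechet_derivative F (at x) (U p)) (at (snd c' p)) w
        + differential N M f p (dir_deriv N (\<lambda>q. components N c' q (U q)) p w))) (at (snd c' p))"
    unfolding up du dF .
  then have "(((\<lambda>q. components M c (f q) (differential N M f q (U q))) \<circ> chart_inv c') has_derivative
      (\<lambda>w. frechet_derivative (\<lambda>x. frechet_derivative F (at x) (U p)) (at (snd c' p)) w
        + differential N M f p (dir_deriv N (\<lambda>q. components N c' q (U q)) p w))) (at (snd c' p))"
    by (rule has_derivative_transform_within_open[OF _ op V])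
      (use components_differential[OF c(1) _ c'(1)] N.chart_inv_chart[OF c'(1)] in \<open>auto simp: F\<close>)
  then show ?thesis
    unfolding has_dir_deriv_def c_def c'_def .
qed

text \<open>In charts the left-hand side has three contributions: the second derivatives of \<open>f\<close>, which
  cancel by symmetry; the connection on coordinate fields, which is symmetric as well; and \<open>df\<close>
  applied to the derivatives of the components of \<open>W\<close> and \<open>U\<close>, which form the bracket.\<close>

lemma nabla_along_torsion_free:
  assumes lc: "levi_civita M g nabla"
    and W: "smooth_vector_field_on N UNIV W" and U: "smooth_vector_field_on N UNIV U"
  shows "nabla_along N M f nabla W (\<lambda>q. differential N M f q (U q)) p
      - nabla_along N M f nabla U (\<lambda>q. differential N M f q (W q)) p
    = differential N M f p (lie_bracket N W U p)"
proof -
  define c where "c = chart_at M (f p)"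
  define c' where "c' = chart_at N p"
  have c: "c \<in> M" "f p \<in> fst c" and c': "c' \<in> N" "p \<in> fst c'"
    using M.chart_at N.chart_at unfolding c_def c'_def by auto
  define F where "F = snd c \<circ> f \<circ> chart_inv c'"
  have "frechet_derivative (\<lambda>x. frechet_derivative F (at x) (U p)) (at (snd c' p)) (W p)
      = frechet_derivative (\<lambda>x. frechet_derivative F (at x) (W p)) (at (snd c' p)) (U p)"
  proof (rule mixed_derivatives_commute)
    show "open (snd c' ` (fst c' \<inter> f -` fst c))" "snd c' p \<in> snd c' ` (fst c' \<inter> f -` fst c)"
      using N.open_chart_image[OF c'(1) open_vimage_domain[OF c(1)]] c c' by auto
    show "smooth_on (snd c' ` (fst c' \<inter> f -` fst c)) F"
      using smooth_chart_comp[OF c(1)] c'(1) unfolding F_def smooth_fun_on_def by blast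
  qed
  then show ?thesis
    unfolding nabla_along_def Let_def lie_bracket_def
      dir_deriv_eq[OF has_dir_deriv_differential[OF U]]
      dir_deriv_eq[OF has_dir_deriv_differential[OF W]]
    by (simp add: M.levi_civita_coord_field_symmetric[OF lc, of "f p" "differential N M f p (W p)"]
        linear_diff[OF linear_differential] F_def c_def c'_def)
qed

text \<open>Fields along \<open>f\<close> need not extend to \<open>M\<close>, so parallelism of \<open>P\<close> cannot be applied to them
  directly. But the matrix of \<open>P\<close> along \<open>f\<close> is pulled back from \<open>M\<close>: by the chain rule its
  derivative is taken on \<open>M\<close>, where parallelism expresses it through the connection of
  coordinate fields.\<close>

lemma nabla_along_parallel_endomorphism:
  assumes con: "affine_connection M nabla" and P: "smooth_endomorphism M P"
    and par: "\<And>V X Y p. open V \<Longrightarrow> smooth_vector_field_on M V X \<Longrightarrow> smooth_vector_field_on M V Y \<Longrightarrow>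
      p \<in> V \<Longrightarrow> nabla X (\<lambda>q. P q (Y q)) p = P p (nabla X Y p)"
    and U: "smooth_vector_field_on N UNIV U"
  shows "nabla_along N M f nabla W (\<lambda>q. P (f q) (differential N M f q (U q))) p
    = P (f p) (nabla_along N M f nabla W (\<lambda>q. differential N M f q (U q)) p)"
proof -
  define c where "c = chart_at M (f p)"
  have c: "c \<in> M" "f p \<in> fst c"
    using M.chart_at unfolding c_def by auto
  note op = M.open_domain[OF c(1)]
  have linP: "linear (P q)" for q
    using P unfolding smooth_endomorphism_def by blast
  define Z where "Z = (\<lambda>q. differential N M f q (U q))"
  define z where "z = (\<lambda>q. components M c (f q) (Z q))"
  define w where "w = differential N M f p (W p)"
  define X where "X = coord_field M c w"
  define L where "L = (\<lambda>v. nabla X (coord_field M c v) (f p))"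
  \<comment> \<open>The columns of the matrix of \<open>P\<close> in the chart \<open>c\<close>.\<close>
  define A where "A = (\<lambda>b y. components M c y (P y (coord_field M c b y)))"
  have X: "smooth_vector_field_on M (fst c) X" "X (f p) = w"
    unfolding X_def c_def using M.smooth_coord_field M.chart_at M.coord_field_chart_at by auto
  have P_coord: "smooth_vector_field_on M (fst c) (\<lambda>y. P y (coord_field M c b y))" for b
    using P op M.smooth_coord_field[OF c(1)] unfolding smooth_endomorphism_def by blast
  have linL: "linear L"
    unfolding L_def by (rule M.linear_connection_coord_field[OF con c X(1)])
  have zp: "z p = Z p"
    unfolding z_def c_def by (rule M.components_chart_at)
  have Ap: "A b (f p) = P (f p) b" for b
    unfolding A_def c_def by (simp add: M.components_chart_at M.coord_field_chart_at)
  obtain Dz where Dz: "has_dir_deriv N z Dz p"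
    using has_dir_deriv_differential[OF U] unfolding z_def Z_def c_def by blast
  have DA: "has_dir_deriv M (A b) (dir_deriv M (A b) (f p)) (f p)" for b
    unfolding A_def by (rule M.has_dir_deriv_components[OF c P_coord])
  have "has_dir_deriv N (\<lambda>q. \<Sum>b\<in>Basis. (z q \<bullet> b) *\<^sub>R A b (f q))
      (\<lambda>v. \<Sum>b\<in>Basis. (z p \<bullet> b) *\<^sub>R dir_deriv M (A b) (f p) (differential N M f p v)
        + (Dz v \<bullet> b) *\<^sub>R A b (f p)) p"
    by (intro has_dir_deriv_sum N.has_dir_deriv_scaleR has_dir_deriv_comp DA
        has_dir_deriv_linear[OF bounded_linear_inner_left] Dz)
  then have "has_dir_deriv N (\<lambda>q. components M c (f q) (P (f q) (Z q)))
      (\<lambda>v. \<Sum>b\<in>Basis. (z p \<bullet> b) *\<^sub>R dir_deriv M (A b) (f p) (differential N M f p v)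
        + (Dz v \<bullet> b) *\<^sub>R A b (f p)) p"
  proof (rule N.has_dir_deriv_cong[OF _ open_vimage_domain[OF c(1)]])
    show "p \<in> f -` fst c" using c by simp
    fix q assume "q \<in> f -` fst c"
    then have q: "f q \<in> fst c" by simp
    have lin: "linear (\<lambda>v. components M c (f q) (P (f q) (coord_field M c v (f q))))"
      using linear_compose[OF linear_compose[OF M.linear_coord_field[OF c(1) q] linP]
          M.linear_components[OF c(1) q]] by (simp add: comp_def)
    show "(\<Sum>b\<in>Basis. (z q \<bullet> b) *\<^sub>R A b (f q)) = components M c (f q) (P (f q) (Z q))"
      using linear_eq_sum_Basis[OF lin, of "z q"] M.coord_field_components[OF c(1) q]
      by (simp add: A_def z_def)
  qed
  then have deriv: "dir_deriv N (\<lambda>q. components M c (f q) (P (f q) (Z q))) p (W p)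
      = (\<Sum>b\<in>Basis. (Z p \<bullet> b) *\<^sub>R dir_deriv M (A b) (f p) w) + P (f p) (Dz (W p))"
    using linear_eq_sum_Basis[OF linP, of "f p" "Dz (W p)"]
    by (simp add: dir_deriv_eq sum.distrib zp Ap w_def)
  have column: "dir_deriv M (A b) (f p) w = P (f p) (L b) - L (P (f p) b)" for b
    using par[OF op X(1) M.smooth_coord_field[OF c(1)] c(2), of b]
      M.connection_in_chart[OF con, of "f p", folded c_def, OF X(1) P_coord, of b]
      M.coord_field_chart_at[of "f p", folded c_def]
    by (simp add: L_def A_def X(2) eq_diff_eq)
  have "(\<Sum>b\<in>Basis. (Z p \<bullet> b) *\<^sub>R dir_deriv M (A b) (f p) w)
      = (\<Sum>b\<in>Basis. (Z p \<bullet> b) *\<^sub>R P (f p) (L b)) - (\<Sum>b\<in>Basis. (Z p \<bullet> b) *\<^sub>R L (P (f p) b))"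
    by (simp add: column scaleR_diff_right sum_subtractf)
  also have "\<dots> = P (f p) (L (Z p)) - L (P (f p) (Z p))"
    using linear_eq_sum_Basis[OF linear_compose[OF linL linP], of "f p" "Z p"]
      linear_eq_sum_Basis[OF linear_compose[OF linP linL], of "f p" "Z p"] by simp
  finally have matrix: "(\<Sum>b\<in>Basis. (Z p \<bullet> b) *\<^sub>R dir_deriv M (A b) (f p) w)
      = P (f p) (L (Z p)) - L (P (f p) (Z p))" .
  have PZ: "nabla_along N M f nabla W (\<lambda>q. P (f q) (Z q)) p
      = dir_deriv N (\<lambda>q. components M c (f q) (P (f q) (Z q))) p (W p) + L (P (f p) (Z p))"
    unfolding nabla_along_def Let_def L_def X_def w_def c_def ..
  have Z: "nabla_along N M f nabla W Z p = Dz (W p) + L (Z p)"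
    using dir_deriv_eq[OF Dz, of "W p"]
    unfolding nabla_along_def Let_def L_def X_def w_def c_def z_def by simp
  show ?thesis
    using PZ Z deriv matrix linear_add[OF linP] unfolding Z_def by simp
qed

end


section \<open>The splitting along a lightlike submanifold\<close>

text \<open>Pairing with the elements of a basis of \<open>A\<close> gives a linear map into \<open>A\<close> that is injective on
  \<open>A\<close> by nondegeneracy, hence maps \<open>A\<close> onto itself; the projection of \<open>v\<close> is the element of \<open>A\<close>
  with the same pairings.\<close>

lemma nondegenerate_projection:
  fixes b :: "'a::euclidean_space \<Rightarrow> 'a \<Rightarrow> real"
  assumes b: "bilinear b" and A: "subspace A" and nd: "nondegenerate_on b A"
  obtains a where "a \<in> A" "\<And>w. w \<in> A \<Longrightarrow> b (v - a) w = 0"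
proof -
  obtain B where B: "B \<subseteq> A" "independent B" "A \<subseteq> span B"
    using basis_exists[of A] by metis
  have fin: "finite B"
    using B(2) independent_imp_finite by blast
  have lin1: "linear (\<lambda>x. b x y)" and lin2: "linear (\<lambda>y. b x y)" for x y
    using b unfolding bilinear_def by auto
  define T where "T = (\<lambda>x. \<Sum>e\<in>B. b x e *\<^sub>R e)"
  have linT: "linear T"
    unfolding T_def
    by (rule linearI)
      (simp_all add: linear_add[OF lin1] linear_scale[OF lin1] scaleR_add_left sum.distrib
        scaleR_right.sum)
  have ortho: "b x w = 0" if "T x = 0" "w \<in> A" for x w
  proof -
    have "b x e = 0" if "e \<in> B" for e
      using B(2) fin \<open>T x = 0\<close> that independentD[of B B "\<lambda>e. b x e" e] unfolding T_def by blast
    then show ?thesis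
      using linear_eq_0_on_span[OF lin2, of B x w] B(3) that(2) by blast
  qed
  have "inj_on T A"
    using linear_injective_on_subspace_0[OF linT A] ortho nd unfolding nondegenerate_on_def by blast
  moreover have "T ` A \<subseteq> A"
    unfolding T_def using B(1) by (auto intro!: subspace_sum[OF A] subspace_scale[OF A])
  moreover have "span A = A"
    using A span_eq_iff by blast
  ultimately have "T ` A = A"
    using subspace_dim_equal[OF linear_subspace_image[OF linT A] A] dim_image_eq[OF linT, of A]
    by (metis order_refl)
  moreover have "T v \<in> A"
    unfolding T_def using B(1) by (auto intro!: subspace_sum[OF A] subspace_scale[OF A])
  ultimately obtain a where "a \<in> A" "T v = T a"
    by (metis imageE)
  then have "T (v - a) = 0"
    by (simp add: linear_diff[OF linT])
  then show ?thesis
    using that[OF \<open>a \<in> A\<close>] ortho by blast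
qed

text \<open>The pointwise picture: \<open>T\<close> is the tangent space, \<open>\<xi>\<close> a basis of its radical and \<open>n\<close> the
  dual null basis of the lightlike transversal space.\<close>

locale lightlike_frame =
  fixes b :: "'a::euclidean_space \<Rightarrow> 'a \<Rightarrow> real" and T S SP :: "'a set"
    and \<xi> n :: "nat \<Rightarrow> 'a" and r :: nat
  assumes bilinear: "bilinear b" and sym: "b v w = b w v"
    and subspaces: "subspace T" "subspace S" "subspace SP"
    and screen: "nondegenerate_complement b S (T \<inter> {v. \<forall>w\<in>T. b v w = 0}) T"
    and screen_transversal: "nondegenerate_complement b SP (T \<inter> {v. \<forall>w\<in>T. b v w = 0})
      {v. \<forall>w\<in>T. b v w = 0}"
    and radical: "T \<inter> {v. \<forall>w\<in>T. b v w = 0} = span (\<xi> ` {..<r})"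
    and n_screen: "i < r \<Longrightarrow> v \<in> S \<union> SP \<Longrightarrow> b (n i) v = 0"
    and n_n: "i < r \<Longrightarrow> j < r \<Longrightarrow> b (n i) (n j) = 0"
    and n_\<xi>: "i < r \<Longrightarrow> j < r \<Longrightarrow> b (n i) (\<xi> j) = (if i = j then 1 else 0)"
begin

abbreviation "rad \<equiv> span (\<xi> ` {..<r})"
abbreviation "ltr \<equiv> span (n ` {..<r})"

lemma lin: "linear (\<lambda>x. b x y)" "linear (\<lambda>y. b x y)"
  using bilinear unfolding bilinear_def by auto

lemma subsets: "S \<subseteq> T" "rad \<subseteq> T"
  "w \<in> T \<Longrightarrow> v \<in> rad \<Longrightarrow> b v w = 0" "w \<in> T \<Longrightarrow> v \<in> SP \<Longrightarrow> b v w = 0"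
proof -
  show "rad \<subseteq> T" "w \<in> T \<Longrightarrow> v \<in> rad \<Longrightarrow> b v w = 0"
    using radical by blast+
  have 0: "0 \<in> rad" by (rule span_zero)
  have "S \<subseteq> {x + y |x y. x \<in> S \<and> y \<in> rad}" "SP \<subseteq> {x + y |x y. x \<in> SP \<and> y \<in> rad}"
    using 0 by (metis (mono_tags, lifting) add.right_neutral mem_Collect_eq subsetI)+
  moreover have "{x + y |x y. x \<in> S \<and> y \<in> rad} = T"
    "{x + y |x y. x \<in> SP \<and> y \<in> rad} = {v. \<forall>w\<in>T. b v w = 0}"
    using screen screen_transversal unfolding nondegenerate_complement_def radical by argo+
  ultimately show "S \<subseteq> T" "w \<in> T \<Longrightarrow> v \<in> SP \<Longrightarrow> b v w = 0"
    by blast+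
qed

lemma ltr_ortho: "l \<in> ltr \<Longrightarrow> v \<in> S \<union> SP \<Longrightarrow> b l v = 0"
  using linear_eq_0_on_span[OF lin(1), of "n ` {..<r}" v l] n_screen by blast

lemma \<xi>_in_rad: "i < r \<Longrightarrow> \<xi> i \<in> rad"
  by (simp add: span_base)

lemma rad_expansion:
  assumes "v \<in> rad"
  shows "v = (\<Sum>i<r. b (n i) v *\<^sub>R \<xi> i)"
proof (rule linear_eq_on_span[OF linear_id[unfolded id_def] _ _ assms])
  show "linear (\<lambda>v. \<Sum>i<r. b (n i) v *\<^sub>R \<xi> i)"
    by (rule linearI)
      (simp_all add: linear_add[OF lin(2)] linear_scale[OF lin(2)] scaleR_add_left sum.distrib
        scaleR_right.sum)
  fix x assume "x \<in> \<xi> ` {..<r}"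
  then obtain j where j: "j < r" "x = \<xi> j" by auto
  have "(\<Sum>i<r. b (n i) x *\<^sub>R \<xi> i) = (\<Sum>i<r. if i = j then \<xi> i else 0)"
    by (rule sum.cong) (auto simp: n_\<xi> j)
  then show "x = (\<Sum>i<r. b (n i) x *\<^sub>R \<xi> i)"
    using j by simp
qed

text \<open>A vector orthogonal to \<open>S\<close> and to the radical is normal, hence lies in \<open>SP + rad\<close>.
  Nondegeneracy of \<open>SP\<close> removes its first part, and pairing with \<open>n\<close> detects the second.\<close>

lemma orthogonal_to_all_imp_zero:
  assumes S: "\<And>w. w \<in> S \<Longrightarrow> b v w = 0" and SP: "\<And>w. w \<in> SP \<Longrightarrow> b v w = 0"
    and \<xi>: "\<And>i. i < r \<Longrightarrow> b v (\<xi> i) = 0" and n: "\<And>i. i < r \<Longrightarrow> b v (n i) = 0"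
  shows "v = 0"
proof -
  have "b v w = 0" if "w \<in> rad" for w
    using linear_eq_0_on_span[OF lin(2), of "\<xi> ` {..<r}" v w] \<xi> that by blast
  then have "b v (s + w) = 0" if "s \<in> S" "w \<in> rad" for s w
    using S that by (simp add: linear_add[OF lin(2)])
  moreover have "T = {x + y |x y. x \<in> S \<and> y \<in> rad}"
    using screen unfolding nondegenerate_complement_def radical by simp
  ultimately have "\<forall>w\<in>T. b v w = 0"
    by blast
  then have "v \<in> {x + y |x y. x \<in> SP \<and> y \<in> rad}"
    using screen_transversal unfolding nondegenerate_complement_def radical by simp
  then obtain s \<rho> where v: "s \<in> SP" "\<rho> \<in> rad" "v = s + \<rho>"
    by blast
  have "b s w = 0" if "w \<in> SP" for w
  proof -
    have "b \<rho> w = 0"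
      using subsets(2,4) v(2) that sym by (metis subsetD)
    then show ?thesis
      using SP[OF that] v(3) by (simp add: linear_add[OF lin(1)])
  qed
  then have "s = 0"
    using screen_transversal v(1) unfolding nondegenerate_complement_def nondegenerate_on_def
    by blast
  then have "v \<in> rad" using v by simp
  then show ?thesis
    using rad_expansion[of v] n sym by simp
qed

text \<open>Subtract the orthogonal projections onto \<open>S\<close> and \<open>SP\<close> and, since \<open>\<xi>\<close> and \<open>n\<close> are dual null
  families, the component along \<open>\<xi>\<close> read off by \<open>n\<close> and vice versa; nothing is left.\<close>

lemma splitting_exists:
  obtains t l s where "t \<in> T" "l \<in> ltr" "s \<in> SP" "v = t + l + s"
proof -
  have nd: "nondegenerate_on b S" "nondegenerate_on b SP"
    using screen screen_transversal unfolding nondegenerate_complement_def by auto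
  let ?x = "\<Sum>i<r. b v (n i) *\<^sub>R \<xi> i" and ?l = "\<Sum>i<r. b v (\<xi> i) *\<^sub>R n i"
  obtain s1 where s1: "s1 \<in> S" "\<And>w. w \<in> S \<Longrightarrow> b (v - s1) w = 0"
    using nondegenerate_projection[OF bilinear subspaces(2) nd(1)] by metis
  obtain s2 where s2: "s2 \<in> SP" "\<And>w. w \<in> SP \<Longrightarrow> b (v - s2) w = 0"
    using nondegenerate_projection[OF bilinear subspaces(3) nd(2)] by metis
  have x: "?x \<in> rad" and l: "?l \<in> ltr"
    by (auto intro!: span_sum span_scale intro: span_base)
  have expand: "b (v - s1 - s2 - ?x - ?l) w = b v w - b s1 w - b s2 w - b ?x w - b ?l w" for w
    by (simp add: linear_diff[OF lin(1)])
  have "v - s1 - s2 - ?x - ?l = 0"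
  proof (rule orthogonal_to_all_imp_zero)
    fix w assume w: "w \<in> S"
    then have "b s2 w = 0" "b ?x w = 0" "b ?l w = 0"
      using subsets x s2(1) ltr_ortho[OF l] by auto
    then show "b (v - s1 - s2 - ?x - ?l) w = 0"
      using s1(2)[OF w] unfolding expand by (simp add: linear_diff[OF lin(1)])
  next
    fix w assume w: "w \<in> SP"
    then have "b w s1 = 0" "b w ?x = 0" "b ?l w = 0"
      using subsets x s1(1) ltr_ortho[OF l] by auto
    then show "b (v - s1 - s2 - ?x - ?l) w = 0"
      using s2(2)[OF w] unfolding expand sym[of w] by (simp add: linear_diff[OF lin(1)])
  next
    fix j assume j: "j < r"
    have \<xi>: "\<xi> j \<in> T" "\<And>w. w \<in> T \<Longrightarrow> b w (\<xi> j) = 0"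
      using \<xi>_in_rad[OF j] subsets(2,3) sym by (auto simp: subset_iff)
    have "b ?l (\<xi> j) = (\<Sum>i<r. b v (\<xi> i) * b (n i) (\<xi> j))"
      by (simp add: linear_sum[OF lin(1)] linear_scale[OF lin(1)])
    also have "\<dots> = (\<Sum>i<r. if i = j then b v (\<xi> j) else 0)"
      by (rule sum.cong) (auto simp: n_\<xi> j)
    also have "\<dots> = b v (\<xi> j)"
      using j by simp
    finally show "b (v - s1 - s2 - ?x - ?l) (\<xi> j) = 0"
      unfolding expand using \<xi> s1(1) s2(1) x subsets by (auto simp: subset_iff)
  next
    fix j assume j: "j < r"
    have "b ?x (n j) = (\<Sum>i<r. b v (n i) * b (n j) (\<xi> i))"
      by (simp add: linear_sum[OF lin(1)] linear_scale[OF lin(1)] sym[of "\<xi> _" "n j"])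
    also have "\<dots> = (\<Sum>i<r. if i = j then b v (n j) else 0)"
      by (rule sum.cong) (auto simp: n_\<xi> j)
    also have "\<dots> = b v (n j)"
      using j by simp
    finally have "b ?x (n j) = b v (n j)" .
    moreover have "b ?l (n j) = 0"
      by (simp add: linear_sum[OF lin(1)] linear_scale[OF lin(1)] n_n j)
    moreover have "b s1 (n j) = 0" "b s2 (n j) = 0"
      using n_screen[OF j] s1(1) s2(1) sym by auto
    ultimately show "b (v - s1 - s2 - ?x - ?l) (n j) = 0"
      unfolding expand by simp
  qed
  then have "v = (s1 + ?x) + ?l + s2"
    by (simp add: algebra_simps)
  moreover have "s1 + ?x \<in> T"
    using subspace_add[OF subspaces(1)] s1(1) x subsets(1,2) by blast
  ultimately show ?thesis
    using that l s2(1) by blast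
qed

text \<open>Tangent and lightlike transversal vectors are both orthogonal to \<open>SP\<close>, so the component in
  the nondegenerate space \<open>SP\<close> is determined by pairing with \<open>SP\<close>.\<close>

lemma splitting_unique:
  assumes "t \<in> T" "l \<in> ltr" "s \<in> SP" "t' \<in> T" "l' \<in> ltr" "s' \<in> SP"
    and eq: "t + l + s = t' + l' + s'"
  shows "s = s'"
proof -
  have "b (s - s') w = 0" if "w \<in> SP" for w
  proof -
    have "s - s' = (t' - t) + (l' - l)"
      using eq by (simp add: algebra_simps eq_diff_eq diff_eq_eq)
    then have "b (s - s') w = b ((t' - t) + (l' - l)) w"
      by simp
    also have "\<dots> = (b t' w - b t w) + (b l' w - b l w)"
      by (simp add: linear_add[OF lin(1)] linear_diff[OF lin(1)])
    also have "\<dots> = 0"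
    proof -
      have "b t w = 0" "b t' w = 0"
        using subsets(4)[OF _ that] assms(1,4) sym by metis+
      then show ?thesis
        using assms(2,5) ltr_ortho that by simp
    qed
    finally show ?thesis .
  qed
  moreover have "s - s' \<in> SP"
    using subspace_diff[OF subspaces(3)] assms by blast
  ultimately have "s - s' = 0"
    using screen_transversal unfolding nondegenerate_complement_def nondegenerate_on_def by blast
  then show ?thesis by simp
qed

definition screen_transversal_part :: "'a \<Rightarrow> 'a" where
  "screen_transversal_part v = (THE s. s \<in> SP \<and> (\<exists>t\<in>T. \<exists>l\<in>ltr. v = t + l + s))"

lemma screen_transversal_part_eq:
  assumes "t \<in> T" "l \<in> ltr" "s \<in> SP" "v = t + l + s"
  shows "screen_transversal_part v = s"
  unfolding screen_transversal_part_def
proof (rule the_equality)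
  show "s \<in> SP \<and> (\<exists>t\<in>T. \<exists>l\<in>ltr. v = t + l + s)" using assms by blast
  fix s' assume "s' \<in> SP \<and> (\<exists>t\<in>T. \<exists>l\<in>ltr. v = t + l + s')"
  then show "s' = s" using splitting_unique[OF _ _ _ assms(1-3)] assms(4) by metis
qed

text \<open>Split \<open>X = \<sigma> + \<rho>\<close> along \<open>S\<close> and the radical. Then \<open>P \<sigma>\<close> is tangent and \<open>P \<rho>\<close> lies in
  \<open>SP\<close>, so \<open>P \<rho>\<close> is the whole screen transversal part of \<open>P X\<close>. A golden structure is injective,
  hence this part vanishes exactly when \<open>\<rho> = 0\<close>.\<close>

lemma golden_screen_criterion:
  assumes P: "linear P" "\<And>v. P (P v) = P v + v" "P ` S \<subseteq> S" "P ` rad \<subseteq> SP"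
    and X: "X \<in> T" and diff: "v - w = P X"
  shows "screen_transversal_part v = screen_transversal_part w \<longleftrightarrow> X \<in> S"
proof -
  obtain t l s where v: "t \<in> T" "l \<in> ltr" "s \<in> SP" "v = t + l + s"
    using splitting_exists by metis
  obtain t' l' s' where w: "t' \<in> T" "l' \<in> ltr" "s' \<in> SP" "w = t' + l' + s'"
    using splitting_exists by metis
  have "X \<in> {x + y |x y. x \<in> S \<and> y \<in> rad}"
    using X screen unfolding nondegenerate_complement_def radical by simp
  then obtain \<sigma> \<rho> where X_eq: "\<sigma> \<in> S" "\<rho> \<in> rad" "X = \<sigma> + \<rho>"
    by blast
  have "s - s' = P \<rho>"
  proof (rule splitting_unique)
    show "t - t' \<in> T" "l - l' \<in> ltr" "s - s' \<in> SP"
      using v w subspaces subspace_diff span_diff by blast+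
    show "P \<sigma> \<in> T" "P \<rho> \<in> SP" "0 \<in> ltr"
      using P(3,4) X_eq subsets(1) span_zero by blast+
    show "(t - t') + (l - l') + (s - s') = P \<sigma> + 0 + P \<rho>"
      using diff v(4) w(4) linear_add[OF P(1), of \<sigma> \<rho>] X_eq(3) by (simp add: algebra_simps)
  qed
  then have "screen_transversal_part v = screen_transversal_part w \<longleftrightarrow> P \<rho> = 0"
    using screen_transversal_part_eq[OF v] screen_transversal_part_eq[OF w] by auto
  also have "\<dots> \<longleftrightarrow> \<rho> = 0"
    using P(2)[of \<rho>] linear_0[OF P(1)] by auto
  also have "\<dots> \<longleftrightarrow> X \<in> S"
  proof
    assume "X \<in> S"
    then have "\<rho> \<in> S"
      using subspace_diff[OF subspaces(2) _ X_eq(1)] X_eq(3) by fastforce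
    then show "\<rho> = 0"
      using X_eq(2) screen unfolding nondegenerate_complement_def radical by blast
  qed (use X_eq in simp)
  finally show ?thesis .
qed

end


section \<open>Integrability of the screen distribution\<close>

theorem theorem4p1:
  fixes M :: "('m::{t2_space, second_countable_topology}, 'e::euclidean_space) atlas"
    and N :: "('n::{t2_space, second_countable_topology}, 'd::euclidean_space) atlas"
    and f :: "'n \<Rightarrow> 'm"
    and g :: "'m \<Rightarrow> 'e \<Rightarrow> 'e \<Rightarrow> real"
    and P :: "'m \<Rightarrow> 'e \<Rightarrow> 'e"
    and nabla :: "('m \<Rightarrow> 'e) \<Rightarrow> ('m \<Rightarrow> 'e) \<Rightarrow> 'm \<Rightarrow> 'e"
    and S SP L :: "'n \<Rightarrow> 'e set"
  assumes "golden_semi_riemannian_manifold M g P nabla"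
    and "lightlike_submanifold N M f g S SP L"
    and "radical_screen_transversal N M f g P S SP"
  shows "integrable_distribution N M f S \<longleftrightarrow>
    (\<forall>W U. tangent_section N M f S W \<and> tangent_section N M f S U \<longrightarrow>
      (\<forall>p. screen_second_fundamental_form N M f nabla SP L W
              (\<lambda>q. P (f q) (differential N M f q (U q))) p =
           screen_second_fundamental_form N M f nabla SP L U
              (\<lambda>q. P (f q) (differential N M f q (W q))) p))"
proof -
  note golden = assms(1)[unfolded golden_semi_riemannian_manifold_def]
  note light = assms(2)[unfolded lightlike_submanifold_def]
  have lc: "levi_civita M g nabla" and P: "smooth_endomorphism M P"
    and PP: "\<And>p v. P p (P p v) = P p v + v"
    and bil: "\<And>p. bilinear (g p)" and sym: "\<And>p v w. g p v w = g p w v"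
    using golden unfolding semi_riemannian_metric_def by auto
  have par: "nabla X (\<lambda>q. P q (Y q)) p = P p (nabla X Y p)"
    if "open V" "smooth_vector_field_on M V X" "smooth_vector_field_on M V Y" "p \<in> V" for V X Y p
    by (rule golden[THEN conjunct2, THEN conjunct2, THEN conjunct2, THEN conjunct2, THEN conjunct2,
          THEN conjunct2, THEN spec[of _ V], THEN spec[of _ X], THEN spec[of _ Y], THEN mp, THEN bspec,
          OF conjI[OF that(1) conjI[OF that(2,3)]] that(4)])
  have con: "affine_connection M nabla"
    using lc unfolding levi_civita_def by blast
  have linP: "linear (P p)" for p
    using P unfolding smooth_endomorphism_def by blast
  interpret smooth_map_between N M f
    using golden light unfolding immersion_def by unfold_locales auto
  obtain r where r: "lightlike_transversal N M f g r S SP L"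
    using light by blast
  have S: "\<And>p. subspace (S p)" and SP: "\<And>p. subspace (SP p)"
    and scr: "\<And>p. nondegenerate_complement (g (f p)) (S p) (radical_bundle N M f g p)
               (tangent_bundle N M f p)"
    and scrt: "\<And>p. nondegenerate_complement (g (f p)) (SP p) (radical_bundle N M f g p)
               (normal_bundle N M f g p)"
    using light unfolding subbundle_def by blast+
  have PS: "\<And>p. P (f p) ` S p = S p" and PR: "\<And>p. P (f p) ` radical_bundle N M f g p \<subseteq> SP p"
    using assms(3) unfolding radical_screen_transversal_def screen_transversal_def by blast+
  \<comment> \<open>The equivalence holds for each pair of fields and at each point separately.\<close>
  have key: "screen_second_fundamental_form N M f nabla SP L W
        (\<lambda>q. P (f q) (differential N M f q (U q))) p =
      screen_second_fundamental_form N M f nabla SP L U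
        (\<lambda>q. P (f q) (differential N M f q (W q))) p
      \<longleftrightarrow> differential N M f p (lie_bracket N W U p) \<in> S p"
    if W: "smooth_vector_field_on N UNIV W" and U: "smooth_vector_field_on N UNIV U" for W U p
  proof -
    obtain B \<xi> n where "p \<in> B" and frame: "\<forall>q\<in>B.
           radical_bundle N M f g q = span ((\<lambda>i. \<xi> i q) ` {..<r}) \<and>
           L q = span ((\<lambda>i. n i q) ` {..<r}) \<and>
           (\<forall>i<r. (\<forall>v\<in>S q \<union> SP q. g (f q) (n i q) v = 0) \<and>
              (\<forall>j<r. g (f q) (n i q) (n j q) = 0 \<and>
                 g (f q) (n i q) (\<xi> j q) = (if i = j then 1 else 0)))"
      using r[unfolded lightlike_transversal_def, THEN spec[of _ p]]
      by (elim exE conjE) (rule that)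
    note frame_p = bspec[OF frame \<open>p \<in> B\<close>]
    have rad: "radical_bundle N M f g p = span ((\<lambda>i. \<xi> i p) ` {..<r})"
      and L: "L p = span ((\<lambda>i. n i p) ` {..<r})"
      using frame_p by blast+
    have tan: "subspace (tangent_bundle N M f p)"
      unfolding tangent_bundle_def using linear_subspace_image[OF linear_differential] by auto
    interpret lightlike_frame "g (f p)" "tangent_bundle N M f p" "S p" "SP p"
      "\<lambda>i. \<xi> i p" "\<lambda>i. n i p" r
      using bil sym tan S SP scr[of p] scrt[of p] frame_p
      unfolding radical_bundle_def normal_bundle_def by unfold_locales auto
    have "nabla_along N M f nabla W (\<lambda>q. P (f q) (differential N M f q (U q))) p
        - nabla_along N M f nabla U (\<lambda>q. P (f q) (differential N M f q (W q))) p
      = P (f p) (differential N M f p (lie_bracket N W U p))"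
      using nabla_along_torsion_free[OF lc W U, of p]
        nabla_along_parallel_endomorphism[OF con P par W, where p = p and W = U]
        nabla_along_parallel_endomorphism[OF con P par U, where p = p and W = W]
        linear_diff[OF linP, symmetric] by simp
    moreover have "P (f p) ` S p \<subseteq> S p" "P (f p) ` span ((\<lambda>i. \<xi> i p) ` {..<r}) \<subseteq> SP p"
      using PS[of p] PR[of p] rad by auto
    moreover have "differential N M f p (lie_bracket N W U p) \<in> tangent_bundle N M f p"
      unfolding tangent_bundle_def by blast
    ultimately show ?thesis
      unfolding screen_second_fundamental_form_def L screen_transversal_part_def[symmetric]
      by (intro golden_screen_criterion[OF linP PP])
  qed
  show ?thesis
    unfolding integrable_distribution_def using key
    unfolding tangent_section_def by blast
qed

end
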